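(* Let $(\mathbb{X},T)$ be a Polish space and let $(\mathbb{X}_n)_{n\ge1}$ be a non-decreasing sequence of open subsets of $\mathbb{X}$ with $\bigcup_{n\ge1}\mathbb{X}_n=\mathbb{X}$. Let $(\mu_n)_{n\ge1}$ be a projective system of point processes on $\mathbb{X}_n$ with respect to the restriction maps $\pi_{mn}:M(\mathbb{X}_m)\to M(\mathbb{X}_n)$, i.e. each $\mu_n$ is a probability measure on $(M(\mathbb{X}_n),\mathcal{M}_n)$ and $\mu_n=\pi_{mn}*\mu_m$ for all $n\le m$. Then the projective limit $\mu_{\mathbb{N}}$ of $(\mu_n)_{n\geq 1}$ exists and corresponds to a probability measure on $(M(\mathbb{X}),\mathcal{M})$, i.e. a point process on $\mathbb{X}$, which is the unique probability measure satisfying $\pi_n*\mu_{\mathbb{N}}=\mu_n$ for all $n\ge1$, where $\pi_n:M(\mathbb{X})\to M(\mathbb{X}_n)$ are the restriction maps.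
   Context: Boundedness of subsets of $\mathbb{X}$, and of subsets of each $\mathbb{X}_n\subseteq\mathbb{X}$, is understood with respect to a fixed complete metric inducing the topology of $\mathbb{X}$. For $\mathbb{Y}=\mathbb{X}$ or $\mathbb{Y}=\mathbb{X}_n$ with Borel $\sigma$-algebra $\mathcal{Y}$, $M(\mathbb{Y})$ denotes the set of locally finite simple counting measures on $\mathbb{Y}$: Borel measures $\xi$ with values in $\{0,1,2,\dots\}\cup\{\infty\}$ such that $\xi(B)<\infty$ for every bounded $B\in\mathcal{Y}$, and $\xi(\{y\})\le1$ for every $y\in\mathbb{Y}$. It carries the $\sigma$-algebra generated by the evaluation maps $\xi\mapsto\xi(A)$, $A\in\mathcal{Y}$. This $\sigma$-algebra is denoted $\mathcal{M}$ for $\mathbb{Y}=\mathbb{X}$ and $\mathcal{M}_n$ for $\mathbb{Y}=\mathbb{X}_n$. A point process on $\mathbb{Y}$ is a random element of $M(\mathbb{Y})$ and is identified with its probability measure on $M(\mathbb{Y})$. Each open $\mathbb{X}_n$ carries the subspace topology, so it is Polish; its Borel $\sigma$-algebra is $\mathcal{X}_n$. Let $\iota_{nm}:\mathbb{X}_n\hookrightarrow\mathbb{X}_m$ ($n\le m$) and $\iota_n:\mathbb{X}_n\hookrightarrow\mathbb{X}$ be the inclusions. The projections (restriction maps) are $\pi_{mn}\xi(A_n)=\xi(\iota_{nm}(A_n))$ and $\pi_n\xi(A_n)=\xi(\iota_n(A_n))$ for $A_n\in\mathcal{X}_n$. Push-forward: $f*\mu(B)=\mu(f^{-1}(B))$.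
   Formalization: Existence on M(X) is proved only if every set bounded in the fixed metric lies in some X_n (some such complete metric is shown to exist), as it fails for N with the 0/1 metric, X_n={0..n} and Dirac masses at counting measure; the projective limit and uniqueness hold for every complete metric. *)

theory Defs
  imports "HOL-Probability.Probability"
begin

definition complete_metric :: "('a::topological_space \<Rightarrow> 'a \<Rightarrow> real) \<Rightarrow> bool" where
  "complete_metric d \<longleftrightarrow> Metric_space UNIV d \<and> Metric_space.mcomplete UNIV d \<and>
     Metric_space.mtopology UNIV d = euclidean"

text \<open>For open \<open>Y\<close> the trace \<open>restrict_space borel Y\<close> is the Borel \<open>\<sigma>\<close>-algebra of the subspace
  topology. Boundedness of a subset of \<open>Y\<close> always refers to the metric \<open>d\<close> of the whole space.\<close>

definition counting_measures ::
  "('a::topological_space \<Rightarrow> 'a \<Rightarrow> real) \<Rightarrow> 'a set \<Rightarrow> 'a measure set" where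
  "counting_measures d Y = {\<xi>. sets \<xi> = sets (restrict_space borel Y) \<and>
     (\<forall>B \<in> sets \<xi>. emeasure \<xi> B \<in> range of_nat \<union> {\<infinity>}) \<and>
     (\<forall>B \<in> sets \<xi>. Metric_space.mbounded UNIV d B \<longrightarrow> emeasure \<xi> B < \<infinity>) \<and>
     (\<forall>y \<in> Y. emeasure \<xi> {y} \<le> 1)}"

text \<open>The measurable space \<open>M(Y)\<close>, as a value of type \<open>measure\<close> of which only \<open>space\<close> and \<open>sets\<close>
  are relevant.\<close>

definition counting_algebra ::
  "('a::topological_space \<Rightarrow> 'a \<Rightarrow> real) \<Rightarrow> 'a set \<Rightarrow> 'a measure measure" where
  "counting_algebra d Y = sigma (counting_measures d Y)
     {{\<xi> \<in> counting_measures d Y. emeasure \<xi> A \<in> C} | A C.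
        A \<in> sets (restrict_space borel Y) \<and> C \<in> sets (borel :: ennreal measure)}"

definition point_process ::
  "('a::topological_space \<Rightarrow> 'a \<Rightarrow> real) \<Rightarrow> 'a set \<Rightarrow> 'a measure measure \<Rightarrow> bool" where
  "point_process d Y P \<longleftrightarrow> prob_space P \<and> sets P = sets (counting_algebra d Y)"

text \<open>The restriction maps are \<open>\<lambda>\<xi>. restrict_space \<xi> (X n)\<close>, both from \<open>M(X m)\<close> and from \<open>M(UNIV)\<close>.
  Indices start at 1; the value \<open>X 0\<close> is never used.\<close>

definition projective_system ::
  "('a::topological_space \<Rightarrow> 'a \<Rightarrow> real) \<Rightarrow> (nat \<Rightarrow> 'a set) \<Rightarrow> (nat \<Rightarrow> 'a measure measure) \<Rightarrow> bool" where
  "projective_system d X \<mu> \<longleftrightarrow> (\<forall>n\<ge>1. point_process d (X n) (\<mu> n)) \<and>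
     (\<forall>n m. 1 \<le> n \<and> n \<le> m \<longrightarrow>
        \<mu> n = distr (\<mu> m) (counting_algebra d (X n)) (\<lambda>\<xi>. restrict_space \<xi> (X n)))"

text \<open>The projective limit of the spaces \<open>M(X n)\<close>: compatible sequences inside the product.\<close>

definition projective_limit_space ::
  "('a::topological_space \<Rightarrow> 'a \<Rightarrow> real) \<Rightarrow> (nat \<Rightarrow> 'a set) \<Rightarrow> (nat \<Rightarrow> 'a measure) measure" where
  "projective_limit_space d X = restrict_space (Pi\<^sub>M {1..} (\<lambda>n. counting_algebra d (X n)))
     {\<xi>. \<forall>n m. 1 \<le> n \<and> n \<le> m \<longrightarrow> restrict_space (\<xi> m) (X n) = \<xi> n}"

definition is_projective_limit ::
  "('a::topological_space \<Rightarrow> 'a \<Rightarrow> real) \<Rightarrow> (nat \<Rightarrow> 'a set) \<Rightarrow> (nat \<Rightarrow> 'a measure measure) \<Rightarrow>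
     (nat \<Rightarrow> 'a measure) measure \<Rightarrow> bool" where
  "is_projective_limit d X \<mu> \<nu> \<longleftrightarrow> prob_space \<nu> \<and> sets \<nu> = sets (projective_limit_space d X) \<and>
     (\<forall>n\<ge>1. distr \<nu> (counting_algebra d (X n)) (\<lambda>\<xi>. \<xi> n) = \<mu> n)"

definition restricts_to ::
  "('a::topological_space \<Rightarrow> 'a \<Rightarrow> real) \<Rightarrow> (nat \<Rightarrow> 'a set) \<Rightarrow> (nat \<Rightarrow> 'a measure measure) \<Rightarrow>
     'a measure measure \<Rightarrow> bool" where
  "restricts_to d X \<mu> P \<longleftrightarrow> point_process d UNIV P \<and>
     (\<forall>n\<ge>1. distr P (counting_algebra d (X n)) (\<lambda>\<xi>. restrict_space \<xi> (X n)) = \<mu> n)"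

text \<open>For an arbitrary complete metric the projective limit need not come from a point process on the
  whole space: take a countably infinite discrete space, whose metric is bounded, \<open>X n\<close> its first \<open>n\<close>
  points, and \<open>\<mu> n\<close> the point mass at counting measure on \<open>X n\<close>. The limiting counting measure is
  infinite on the bounded set \<open>UNIV\<close>. Such behaviour is excluded precisely by the following condition.\<close>

definition bounded_exhaustion ::
  "('a::topological_space \<Rightarrow> 'a \<Rightarrow> real) \<Rightarrow> (nat \<Rightarrow> 'a set) \<Rightarrow> bool" where
  "bounded_exhaustion d X \<longleftrightarrow> (\<forall>B. Metric_space.mbounded UNIV d B \<longrightarrow> (\<exists>n\<ge>1. B \<subseteq> X n))"

end

theory Submission
  imports Defs
begin

text \<open>Regularity of the spaces \<open>M(X n)\<close> is avoided by encoding configurations as sequences of points.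
  Cut the space into countably many bounded Borel pieces \<open>D p\<close>, each contained in some \<open>X n\<close> and
  disjoint from the earlier ones, and fix a countable base \<open>U i\<close>. The code of \<open>\<xi>\<close> records, for every
  pair \<open>(p, i)\<close>, the unique point of \<open>\<xi>\<close> in \<open>D p \<inter> U i\<close> when \<open>\<xi> (D p \<inter> U i) = 1\<close>. Codes live in a
  countable power of a Polish space, so Kolmogorov's theorem yields a law of codes whose coordinates
  in the pieces of \<open>X n\<close> are distributed as under \<open>\<mu> n\<close>. Every point of \<open>\<xi>\<close> is isolated by some
  \<open>U i\<close>, so decoding inverts the code; as it is measurable and defined on all codes, it transports
  this law to the required limit measures. Uniqueness holds because the sets determined by a single
  restriction form an intersection-stable generator. A metric with bounded exhaustion is
  \<open>dist x y + \<bar>f x - f y\<bar>\<close> for a continuous \<open>f\<close> whose sublevel sets lie in the \<open>X n\<close>.\<close>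

section \<open>Kolmogorov extension along levels\<close>

text \<open>A coordinate of a code is a point paired with a real flag, so the extension theorem is
  applied over a product of two Polish spaces.\<close>

instance prod :: (polish_space, polish_space) polish_space ..

text \<open>The law of finitely many coordinates is read off from \<open>\<mu> n\<close> for some
  \<open>n\<close> dominating their levels; \<open>cons\<close> makes the choice of \<open>n\<close>
  irrelevant and gives the consistency that Kolmogorov's theorem asks for. The coordinates of level
  at most \<open>n\<close> may form an infinite set, so their joint law is identified on finite
  cylinders.\<close>

lemma kolmogorov_extension_levels:
  fixes \<mu> :: "nat \<Rightarrow> 'm measure" and e :: "'m \<Rightarrow> 'j \<Rightarrow> 'b::polish_space" and lev :: "'j \<Rightarrow> nat"
  assumes prob: "\<And>n. 1 \<le> n \<Longrightarrow> prob_space (\<mu> n)"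
    and meas: "\<And>n j. 1 \<le> n \<Longrightarrow> (\<lambda>x. e x j) \<in> borel_measurable (\<mu> n)"
    and cons: "\<And>n m J. 1 \<le> n \<Longrightarrow> n \<le> m \<Longrightarrow> finite J \<Longrightarrow> (\<forall>j\<in>J. lev j \<le> n) \<Longrightarrow>
      distr (\<mu> n) (Pi\<^sub>M J (\<lambda>_. borel)) (\<lambda>x. restrict (e x) J) =
      distr (\<mu> m) (Pi\<^sub>M J (\<lambda>_. borel)) (\<lambda>x. restrict (e x) J)"
  obtains L where "prob_space L" "sets L = sets (Pi\<^sub>M UNIV (\<lambda>_. borel))"
    "\<And>n. 1 \<le> n \<Longrightarrow> distr L (Pi\<^sub>M {j. lev j \<le> n} (\<lambda>_. borel)) (\<lambda>\<omega>. restrict \<omega> {j. lev j \<le> n}) =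
       distr (\<mu> n) (Pi\<^sub>M {j. lev j \<le> n} (\<lambda>_. borel)) (\<lambda>x. restrict (e x) {j. lev j \<le> n})"
proof -
  \<comment> \<open>Inserting 1 keeps the maximum defined for empty \<open>J\<close> and keeps the
    index in the range where \<open>\<mu>\<close> is constrained.\<close>
  define N where "N J = Max (insert 1 (lev ` J))" for J
  define P where "P J = distr (\<mu> (N J)) (Pi\<^sub>M J (\<lambda>_. borel)) (\<lambda>x. restrict (e x) J)" for J
  have N1: "1 \<le> N J" if "finite J" for J
    using that by (simp add: N_def)
  have Nle: "lev j \<le> N J" if "finite J" "j \<in> J" for J j
    using that by (simp add: N_def)
  have emeas [measurable]: "(\<lambda>x. restrict (e x) J) \<in> \<mu> n \<rightarrow>\<^sub>M Pi\<^sub>M J (\<lambda>_. borel)" if "1 \<le> n" for n J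
    using meas[OF that] by (intro measurable_restrict)
  interpret polish_projective UNIV P
  proof (intro polish_projective.intro projective_family.intro)
    fix J H :: "'j set" assume *: "J \<subseteq> H" "finite H" "H \<subseteq> UNIV"
    then have fJ: "finite J" using finite_subset by blast
    have "N J \<le> N H"
      unfolding N_def using * by (intro Max_mono) auto
    have "distr (P H) (Pi\<^sub>M J (\<lambda>_. borel)) (\<lambda>f. restrict f J) =
       distr (\<mu> (N H)) (Pi\<^sub>M J (\<lambda>_. borel)) (\<lambda>x. restrict (restrict (e x) H) J)"
      unfolding P_def using emeas[OF N1[OF \<open>finite H\<close>]] *
      by (subst distr_distr) (auto simp: o_def intro!: measurable_restrict_subset)
    also have "\<dots> = distr (\<mu> (N H)) (Pi\<^sub>M J (\<lambda>_. borel)) (\<lambda>x. restrict (e x) J)"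
      using * by (simp add: inf.absorb2)
    also have "\<dots> = P J"
      unfolding P_def using cons[OF N1[OF fJ] \<open>N J \<le> N H\<close> fJ] Nle[OF fJ] by simp
    finally show "P J = distr (P H) (Pi\<^sub>M J (\<lambda>_. borel)) (\<lambda>f. restrict f J)" ..
  next
    fix J :: "'j set" assume "finite J"
    then show "prob_space (P J)"
      unfolding P_def using N1 prob emeas by (intro prob_space.prob_space_distr) auto
  qed
  have lev_law: "distr lim (Pi\<^sub>M {j. lev j \<le> n} (\<lambda>_. borel)) (\<lambda>\<omega>. restrict \<omega> {j. lev j \<le> n}) =
       distr (\<mu> n) (Pi\<^sub>M {j. lev j \<le> n} (\<lambda>_. borel)) (\<lambda>x. restrict (e x) {j. lev j \<le> n})"
    (is "?l = ?r") if n: "1 \<le> n" for n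
  proof (rule measure_eqI_PiM_infinite)
    let ?I = "{j. lev j \<le> n}"
    have restr [measurable]: "(\<lambda>\<omega>. restrict \<omega> ?I) \<in> lim \<rightarrow>\<^sub>M Pi\<^sub>M ?I (\<lambda>_. borel)"
      by (simp cong: measurable_cong_sets add: measurable_restrict_subset)
    note [measurable] = emeas[OF n]
    show "finite_measure ?l"
      by (intro prob_space_imp_sigma_finite prob_space.finite_measure P.prob_space_distr) measurable
    fix A :: "'j \<Rightarrow> 'b set" and J assume J: "finite J" "J \<subseteq> ?I" and A: "\<And>j. j \<in> J \<Longrightarrow> A j \<in> sets borel"
    have s: "Pi\<^sub>E J A \<in> sets (Pi\<^sub>M J (\<lambda>_. borel))"
      using J A by (intro sets_PiM_I_finite) auto
    have s': "prod_emb ?I (\<lambda>_. borel) J (Pi\<^sub>E J A) \<in> sets (Pi\<^sub>M ?I (\<lambda>_. borel))"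
      using J A by (intro sets_PiM_I) auto
    have "N J \<le> n"
      unfolding N_def using J n by auto
    have "emeasure ?l (prod_emb ?I (\<lambda>_. borel) J (Pi\<^sub>E J A)) = emeasure lim (emb UNIV J (Pi\<^sub>E J A))"
      unfolding emeasure_distr[OF restr s'] using J
      by (intro arg_cong[where f="emeasure lim"]) (auto simp: prod_emb_def space_PiM Int_absorb1)
    also have "\<dots> = emeasure (P J) (Pi\<^sub>E J A)"
      using J s by (intro emeasure_lim_emb) auto
    also have "P J = distr (\<mu> n) (Pi\<^sub>M J (\<lambda>_. borel)) (\<lambda>x. restrict (e x) J)"
      unfolding P_def using J Nle[OF J(1)] by (intro cons[OF N1[OF J(1)] \<open>N J \<le> n\<close> J(1)]) auto
    also have "emeasure \<dots> (Pi\<^sub>E J A) = emeasure ?r (prod_emb ?I (\<lambda>_. borel) J (Pi\<^sub>E J A))"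
      unfolding emeasure_distr[OF emeas[OF n] s'] emeasure_distr[OF emeas[OF n] s] using J
      by (intro arg_cong[where f="emeasure (\<mu> n)"]) (auto simp: prod_emb_def Int_absorb1)
    finally show "emeasure ?l (prod_emb ?I (\<lambda>_. borel) J (Pi\<^sub>E J A)) =
        emeasure ?r (prod_emb ?I (\<lambda>_. borel) J (Pi\<^sub>E J A))" .
  qed simp_all
  show thesis
    by (rule that[OF P.prob_space_axioms _ lev_law]) simp_all
qed

section \<open>Locally finite counting measures and their atoms\<close>

lemma space_counting_algebra [simp]: "space (counting_algebra d Y) = counting_measures d Y"
  by (simp add: counting_algebra_def space_measure_of_conv)

lemma counting_algebra_generator_subset:
  "{{\<xi> \<in> counting_measures d Y. emeasure \<xi> A \<in> C} | A C.
        A \<in> sets (restrict_space borel Y) \<and> C \<in> sets (borel :: ennreal measure)} \<subseteq> Pow (counting_measures d Y)"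
  by auto

lemma measurable_emeasure_counting_algebra:
  assumes "A \<in> sets (restrict_space borel Y)"
  shows "(\<lambda>\<xi>. emeasure \<xi> A) \<in> borel_measurable (counting_algebra d Y)"
proof (rule measurableI)
  fix C :: "ennreal set" assume "C \<in> sets borel"
  then have "{\<xi> \<in> counting_measures d Y. emeasure \<xi> A \<in> C} \<in> sets (counting_algebra d Y)"
    unfolding counting_algebra_def sets_measure_of[OF counting_algebra_generator_subset]
    using assms by blast
  also have "{\<xi> \<in> counting_measures d Y. emeasure \<xi> A \<in> C} =
      (\<lambda>\<xi>. emeasure \<xi> A) -` C \<inter> space (counting_algebra d Y)" by auto
  finally show "(\<lambda>\<xi>. emeasure \<xi> A) -` C \<inter> space (counting_algebra d Y) \<in> sets (counting_algebra d Y)" .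
qed simp

lemma measurable_counting_algebraI:
  assumes "\<And>x. x \<in> space M \<Longrightarrow> f x \<in> counting_measures d Y"
    and m: "\<And>A. A \<in> sets (restrict_space borel Y) \<Longrightarrow> (\<lambda>x. emeasure (f x) A) \<in> borel_measurable M"
  shows "f \<in> M \<rightarrow>\<^sub>M counting_algebra d Y"
  unfolding counting_algebra_def
proof (rule measurable_measure_of[OF counting_algebra_generator_subset])
  show "f \<in> space M \<rightarrow> counting_measures d Y" using assms by auto
  fix S assume "S \<in> {{\<xi> \<in> counting_measures d Y. emeasure \<xi> A \<in> C} | A C.
        A \<in> sets (restrict_space borel Y) \<and> C \<in> sets (borel :: ennreal measure)}"
  then obtain A C where S: "S = {\<xi> \<in> counting_measures d Y. emeasure \<xi> A \<in> C}"
    and A: "A \<in> sets (restrict_space borel Y)" "C \<in> sets (borel :: ennreal measure)" by auto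
  have "f -` S \<inter> space M = (\<lambda>x. emeasure (f x) A) -` C \<inter> space M"
    using S assms(1) by auto
  then show "f -` S \<inter> space M \<in> sets M"
    using measurable_sets[OF m[OF A(1)] A(2)] by simp
qed

lemma space_counting_measure:
  assumes "\<xi> \<in> counting_measures d Y"
  shows "space \<xi> = Y"
  using assms sets_eq_imp_space_eq[of \<xi> "restrict_space borel Y"]
  by (simp add: counting_measures_def space_restrict_space)

lemma restrict_counting_measures:
  assumes "Y \<in> sets borel" "Z \<in> sets borel" "Y \<subseteq> Z" and \<xi>: "\<xi> \<in> counting_measures d Z"
  shows "restrict_space \<xi> Y \<in> counting_measures d Y"
    and "A \<in> sets (restrict_space borel Y) \<Longrightarrow> emeasure (restrict_space \<xi> Y) A = emeasure \<xi> A"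
    and "sets (restrict_space \<xi> Y) = sets (restrict_space borel Y)"
proof -
  have s: "sets \<xi> = sets (restrict_space borel Z)"
    using \<xi> by (simp add: counting_measures_def)
  have sp: "space \<xi> = Z"
    using \<xi> by (rule space_counting_measure)
  have Y: "Y \<inter> space \<xi> \<in> sets \<xi>"
    using assms by (simp add: s sp sets_restrict_space_iff inf.absorb1)
  show sets: "sets (restrict_space \<xi> Y) = sets (restrict_space borel Y)"
    using assms by (auto simp: s sets_restrict_space_cong[OF s] sets_restrict_restrict_space inf.absorb2)
  have sub: "A \<subseteq> Y \<and> A \<in> sets \<xi>" if "A \<in> sets (restrict_space borel Y)" for A
    using that assms by (auto simp: s sets_restrict_space_iff)
  show em: "emeasure (restrict_space \<xi> Y) A = emeasure \<xi> A" if "A \<in> sets (restrict_space borel Y)" for A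
    using sub[OF that] Y by (simp add: emeasure_restrict_space)
  have "emeasure (restrict_space \<xi> Y) {y} \<le> 1" if "y \<in> Y" for y
    using that \<open>Y \<subseteq> Z\<close> \<xi> Y by (auto simp: emeasure_restrict_space counting_measures_def)
  with sub \<xi> show "restrict_space \<xi> Y \<in> counting_measures d Y"
    by (auto simp: counting_measures_def sets em)
qed

lemma measurable_restrict_counting_algebra:
  assumes "Y \<in> sets borel" "Z \<in> sets borel" "Y \<subseteq> Z"
  shows "(\<lambda>\<xi>. restrict_space \<xi> Y) \<in> counting_algebra d Z \<rightarrow>\<^sub>M counting_algebra d Y"
proof (rule measurable_counting_algebraI)
  fix A assume A: "A \<in> sets (restrict_space borel Y)"
  then have "A \<in> sets (restrict_space borel Z)"
    using assms by (auto simp: sets_restrict_space_iff)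
  from measurable_emeasure_counting_algebra[OF this]
  show "(\<lambda>\<xi>. emeasure (restrict_space \<xi> Y) A) \<in> borel_measurable (counting_algebra d Z)"
    by (rule measurable_cong[THEN iffD1, rotated])
      (simp add: restrict_counting_measures(2)[OF assms _ A])
qed (simp add: restrict_counting_measures(1)[OF assms])

lemma restrict_restrict_counting_measures:
  assumes "Y \<in> sets borel" "Z \<in> sets borel" "W \<in> sets borel" "Y \<subseteq> Z" "Z \<subseteq> W" "\<xi> \<in> counting_measures d W"
  shows "restrict_space (restrict_space \<xi> Z) Y = restrict_space \<xi> Y"
proof -
  have s: "sets \<xi> = sets (restrict_space borel W)"
    using assms by (simp add: counting_measures_def)
  have sp: "space \<xi> = W"
    using assms(6) by (rule space_counting_measure)
  show ?thesis
    using assms by (subst restrict_restrict_space)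
      (auto simp: s sp sets_restrict_space_iff inf.absorb1 inf.absorb2 intro: sets.Int)
qed

lemma sets_counting_measure:
  assumes "\<xi> \<in> counting_measures d Y" "Y \<in> sets borel"
  shows "A \<in> sets \<xi> \<longleftrightarrow> A \<subseteq> Y \<and> A \<in> sets borel"
  using assms by (auto simp: counting_measures_def sets_restrict_space_iff)

section \<open>Integer-valued measures as counts of atoms\<close>

lemma counting_measure_values:
  assumes "\<xi> \<in> counting_measures d Y"
  shows "emeasure \<xi> A \<in> range of_nat \<union> {\<infinity>}"
proof (cases "A \<in> sets \<xi>")
  case False
  then show ?thesis by (auto simp: emeasure_notin_sets intro!: image_eqI[where x=0])
qed (use assms in \<open>auto simp: counting_measures_def\<close>)

text \<open>A set of minimal positive mass carries a two-valued measure, which is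
  concentrated on the intersection of the basic open sets and complements of full mass.\<close>

lemma integer_valued_measure_atom:
  fixes \<xi> :: "'a::{t2_space, second_countable_topology} measure"
  assumes vals: "\<And>B. emeasure \<xi> B \<in> range of_nat \<union> {\<infinity>}"
    and sets_Int: "\<And>B C. B \<in> sets \<xi> \<Longrightarrow> open C \<Longrightarrow> B \<inter> C \<in> sets \<xi>"
    and A: "A \<in> sets \<xi>" "0 < emeasure \<xi> A" "emeasure \<xi> A < \<infinity>"
  obtains x where "x \<in> A" "0 < emeasure \<xi> {x}"
proof -
  define Q where "Q n \<longleftrightarrow> 0 < n \<and> (\<exists>B\<in>sets \<xi>. B \<subseteq> A \<and> emeasure \<xi> B = of_nat n)" for n :: nat
  have "\<exists>n. Q n"
    using vals[of A] A by (auto simp: Q_def)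
  define n where "n = (LEAST n. Q n)"
  have "Q n"
    unfolding n_def using \<open>\<exists>n. Q n\<close> by (rule LeastI_ex)
  then obtain B where B: "0 < n" "B \<in> sets \<xi>" "B \<subseteq> A" "emeasure \<xi> B = of_nat n"
    by (auto simp: Q_def)
  have two_valued: "emeasure \<xi> C = 0 \<or> emeasure \<xi> C = of_nat n" if C: "C \<in> sets \<xi>" "C \<subseteq> B" for C
  proof -
    have le: "emeasure \<xi> C \<le> of_nat n"
      using emeasure_mono[OF C(2) B(2)] B(4) by simp
    then obtain k where k: "emeasure \<xi> C = of_nat k"
      using vals[of C] by (auto simp: top_unique)
    then have "k \<le> n" using le by simp
    moreover have "n \<le> k" if "0 < k"
      unfolding n_def using that C B k by (intro Least_le) (auto simp: Q_def)
    ultimately show ?thesis using k by (cases "k = 0") auto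
  qed
  obtain \<B> :: "'a set set" where \<B>: "countable \<B>" "topological_basis \<B>"
    using ex_countable_basis by blast
  \<comment> \<open>\<open>G V\<close> is whichever of \<open>V\<close> and its complement is null
    within \<open>B\<close>. Removing these countably many null sets leaves a core of mass
    \<open>n\<close>, which turns out to be a single point.\<close>
  define G where "G V = (if emeasure \<xi> (B \<inter> V) = 0 then V else - V)" for V
  have "B \<inter> V \<in> sets \<xi>" if "V \<in> \<B>" for V
    using B(2) sets_Int topological_basis_open[OF \<B>(2) that] by blast
  then have G_sets: "B \<inter> G V \<in> sets \<xi>" if "V \<in> \<B>" for V
    using that sets.Diff[OF B(2), of "B \<inter> V"] by (simp add: G_def Diff_Int Diff_eq[symmetric])
  have G_null: "emeasure \<xi> (B \<inter> G V) = 0" if "V \<in> \<B>" for V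
  proof (cases "emeasure \<xi> (B \<inter> V) = 0")
    case False
    have V: "B \<inter> V \<in> sets \<xi>"
      using B(2) sets_Int topological_basis_open[OF \<B>(2) that] by blast
    have "emeasure \<xi> (B \<inter> V) = of_nat n"
      using two_valued[OF V] False by auto
    then have "emeasure \<xi> (B - B \<inter> V) = 0"
      using B V by (subst emeasure_Diff) auto
    then show ?thesis using False by (simp add: G_def Diff_eq Int_Un_distrib)
  qed (simp add: G_def)
  have "(\<Union>V\<in>\<B>. B \<inter> G V) \<in> null_sets \<xi>"
    using \<B>(1) G_sets G_null by (intro null_sets_UN') auto
  then have core: "emeasure \<xi> (B - (\<Union>V\<in>\<B>. B \<inter> G V)) = of_nat n"
    using B by (subst emeasure_Diff) auto
  then have "B - (\<Union>V\<in>\<B>. B \<inter> G V) \<noteq> {}"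
    using \<open>0 < n\<close> by (metis emeasure_empty of_nat_0_less_iff less_irrefl of_nat_0)
  then obtain x where x: "x \<in> B - (\<Union>V\<in>\<B>. B \<inter> G V)" by blast
  \<comment> \<open>A basic \<open>V\<close> containing \<open>x\<close> but not \<open>y\<close>
    must have its complement as null side, since \<open>x\<close> was not removed; but then
    \<open>y\<close> would have been removed.\<close>
  have "y = x" if y: "y \<in> B - (\<Union>V\<in>\<B>. B \<inter> G V)" for y
  proof (rule ccontr)
    assume "y \<noteq> x"
    then obtain W where "open W" "x \<in> W" "y \<notin> W"
      using t1_space by metis
    then obtain V where V: "V \<in> \<B>" "x \<in> V" "V \<subseteq> W"
      using topological_basisE[OF \<B>(2)] by metis
    then have "x \<notin> G V" "y \<notin> G V" using x y by auto
    then show False using V \<open>y \<notin> W\<close> by (auto simp: G_def split: if_splits)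
  qed
  with x have "B - (\<Union>V\<in>\<B>. B \<inter> G V) = {x}" by blast
  with core \<open>0 < n\<close> have "0 < emeasure \<xi> {x}" by simp
  with x B(3) show thesis by (intro that[of x]) auto
qed

text \<open>Simplicity and integrality leave only the masses 0 and 1 for points of \<open>Y\<close>;
  a singleton outside \<open>Y\<close> is not measurable and so has \<open>emeasure\<close>
  0.\<close>

lemma counting_measure_atom_iff:
  assumes "\<xi> \<in> counting_measures d Y"
  shows "0 < emeasure \<xi> {x} \<longleftrightarrow> emeasure \<xi> {x} = 1"
proof
  assume pos: "0 < emeasure \<xi> {x}"
  then have "{x} \<in> sets \<xi>" by (metis emeasure_notin_sets less_irrefl)
  then have "x \<in> Y" using sets.sets_into_space space_counting_measure[OF assms] by blast
  then have le: "emeasure \<xi> {x} \<le> 1" using assms by (auto simp: counting_measures_def)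
  then obtain k :: nat where k: "emeasure \<xi> {x} = of_nat k"
    using counting_measure_values[OF assms, of "{x}"] by (auto simp: top_unique)
  have "k \<le> 1" using le unfolding k by (metis of_nat_1 of_nat_le_iff)
  moreover have "k \<noteq> 0" using pos k by auto
  ultimately show "emeasure \<xi> {x} = 1" using k by (cases k) auto
qed simp

text \<open>A finite set of atoms has mass equal to its cardinality, so the integer mass of
  \<open>A\<close> bounds the number of atoms. If the rest of \<open>A\<close> had positive mass,
  \<open>integer_valued_measure_atom\<close> would find one more atom there.\<close>

lemma counting_measure_eq_card_atoms:
  fixes Y :: "'a::polish_space set"
  assumes \<xi>: "\<xi> \<in> counting_measures d Y" and Y: "Y \<in> sets borel"
    and A: "A \<in> sets \<xi>" "emeasure \<xi> A < \<infinity>"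
  shows "finite {x \<in> A. emeasure \<xi> {x} = 1}"
    and "emeasure \<xi> A = emeasure (count_space UNIV) {x \<in> A. emeasure \<xi> {x} = 1}"
proof -
  let ?F = "{x \<in> A. emeasure \<xi> {x} = 1}"
  note S = sets_counting_measure[OF \<xi> Y]
  obtain N :: nat where N: "emeasure \<xi> A = of_nat N"
    using counting_measure_values[OF \<xi>, of A] A by auto
  have fin: "emeasure \<xi> F = of_nat (card F)" if "finite F" "F \<subseteq> ?F" for F
  proof -
    have sing: "{x} \<in> sets \<xi>" if "x \<in> F" for x
      using that \<open>F \<subseteq> ?F\<close> A(1) by (auto simp: S)
    have "emeasure \<xi> F = (\<Sum>x\<in>F. emeasure \<xi> {x})"
      using that sing by (intro emeasure_eq_sum_singleton)
    also have "\<dots> = (\<Sum>x\<in>F. 1)" using that by (intro sum.cong) auto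
    finally show ?thesis by simp
  qed
  have "card F \<le> N" if "F \<subseteq> ?F" "finite F" for F
  proof -
    have "emeasure \<xi> F \<le> emeasure \<xi> A"
      using that A(1) by (intro emeasure_mono) auto
    then show ?thesis unfolding fin[OF that(2,1)] N by simp
  qed
  then show F: "finite ?F"
    using finite_if_finite_subsets_card_bdd by blast
  have "?F \<in> sets borel" using F by (simp add: borel_closed finite_imp_closed)
  then have Fs: "?F \<in> sets \<xi>" using A(1) by (auto simp: S)
  have "emeasure \<xi> (A - ?F) = 0"
  proof (rule ccontr)
    assume "emeasure \<xi> (A - ?F) \<noteq> 0"
    then have pos: "0 < emeasure \<xi> (A - ?F)" by (simp add: zero_less_iff_neq_zero)
    have "emeasure \<xi> (A - ?F) \<le> emeasure \<xi> A"
      using A(1) by (intro emeasure_mono) auto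
    then have "emeasure \<xi> (A - ?F) < \<infinity>"
      using A(2) by (rule le_less_trans)
    moreover have "B \<inter> C \<in> sets \<xi>" if "B \<in> sets \<xi>" "open C" for B C
      using that by (auto simp: S)
    ultimately obtain x where "x \<in> A - ?F" "0 < emeasure \<xi> {x}"
      using integer_valued_measure_atom[of \<xi> "A - ?F", OF counting_measure_values[OF \<xi>] _ sets.Diff[OF A(1) Fs] pos]
      by blast
    then show False using counting_measure_atom_iff[OF \<xi>] by auto
  qed
  then have "emeasure \<xi> A = emeasure \<xi> ?F"
    using emeasure_Diff_null_set[of "A - ?F" \<xi> A] sets.Diff[OF A(1) Fs] A(1)
    by (simp add: null_sets_def double_diff)
  then show "emeasure \<xi> A = emeasure (count_space UNIV) ?F"
    using fin[OF F] F by simp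
qed

text \<open>The sequence may repeat values, so each value is counted at its first admissible index.
  This turns a cardinality into a series whose terms only involve finitely many equality tests,
  which is what measurability of decoding rests on.\<close>

lemma emeasure_count_space_range:
  fixes x :: "nat \<Rightarrow> 'a"
  shows "emeasure (count_space UNIV) {x i |i. P i} =
    (\<Sum>i. of_bool (P i \<and> (\<forall>j<i. \<not> (P j \<and> x j = x i))))"
proof -
  let ?I = "{i. P i \<and> (\<forall>j<i. \<not> (P j \<and> x j = x i))}"
  have inj: "inj_on x ?I"
    by (intro inj_onI) (metis (mono_tags, lifting) linorder_neqE_nat mem_Collect_eq)
  have "x i \<in> x ` ?I" if "P i" for i
  proof -
    define k where "k = (LEAST k. P k \<and> x k = x i)"
    have "P k \<and> x k = x i" unfolding k_def using that by (rule_tac LeastI) auto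
    moreover have "\<forall>j<k. \<not> (P j \<and> x j = x i)" unfolding k_def using not_less_Least by blast
    ultimately show ?thesis by (intro image_eqI[where x=k]) auto
  qed
  then have img: "{x i |i. P i} = x ` ?I" by auto
  have "emeasure (count_space UNIV) {x i |i. P i} = emeasure (count_space UNIV) ?I"
    unfolding img using inj by (simp add: emeasure_count_space finite_image_iff card_image)
  also have "\<dots> = (\<integral>\<^sup>+i. indicator ?I i \<partial>count_space UNIV)" by simp
  also have "\<dots> = (\<Sum>i. of_bool (P i \<and> (\<forall>j<i. \<not> (P j \<and> x j = x i))))"
    unfolding nn_integral_count_space_nat by (intro suminf_cong) (simp add: indicator_def)
  finally show ?thesis .
qed

section \<open>Codes of configurations\<close>

text \<open>The real component is a flag, with 1 marking a recorded point. Membership in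
  \<open>D p\<close> is tested because an arbitrary code need not respect the pieces.\<close>

definition flagged_points :: "(nat \<Rightarrow> 'a set) \<Rightarrow> (nat \<times> nat \<Rightarrow> 'a \<times> real) \<Rightarrow> nat \<Rightarrow> 'a set" where
  "flagged_points D \<omega> p = {fst (\<omega> (p, i)) | i. snd (\<omega> (p, i)) = 1 \<and> fst (\<omega> (p, i)) \<in> D p}"

text \<open>Pieces with infinitely many flagged points are discarded, so that every code, and not only
  almost every one, decodes to a locally finite configuration.\<close>

definition config :: "(nat \<Rightarrow> 'a set) \<Rightarrow> (nat \<times> nat \<Rightarrow> 'a \<times> real) \<Rightarrow> 'a set" where
  "config D \<omega> = (\<Union>p\<in>{p. finite (flagged_points D \<omega> p)}. flagged_points D \<omega> p)"

text \<open>Pushing forward along the identity changes only the \<sigma>-algebra: counting measure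
  on all subsets of the configuration in \<open>Y\<close> becomes a measure on the Borel sets of
  \<open>Y\<close>.\<close>

definition decode ::
  "(nat \<Rightarrow> 'a set) \<Rightarrow> 'a set \<Rightarrow> (nat \<times> nat \<Rightarrow> 'a \<times> real) \<Rightarrow> 'a::topological_space measure" where
  "decode D Y \<omega> = distr (count_space (config D \<omega> \<inter> Y)) (restrict_space borel Y) (\<lambda>x. x)"

text \<open>Flag 0 makes the point component irrelevant, hence \<open>undefined\<close>. A set that
  is not measurable for \<open>\<xi>\<close> has mass 0 and gets flag 0, so one formula serves the
  measures on all the \<open>X n\<close>.\<close>

definition code ::
  "(nat \<Rightarrow> 'a set) \<Rightarrow> (nat \<Rightarrow> 'a set) \<Rightarrow> 'a measure \<Rightarrow> nat \<times> nat \<Rightarrow> 'a \<times> real" where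
  "code D U \<xi> j = (let B = D (fst j) \<inter> U (snd j) in
     if emeasure \<xi> B = 1 then (THE x. x \<in> B \<and> emeasure \<xi> {x} = 1, 1) else (undefined, 0))"

section \<open>Decoding: from codes to counting measures\<close>

lemma flagged_points_subset: "flagged_points D \<omega> p \<subseteq> D p"
  by (auto simp: flagged_points_def)

lemma sets_decode [simp]: "sets (decode D Y \<omega>) = sets (restrict_space borel Y)"
  by (simp add: decode_def)

lemma emeasure_decode:
  assumes "Y \<in> sets borel" "A \<in> sets (restrict_space borel Y)"
  shows "emeasure (decode D Y \<omega>) A = emeasure (count_space UNIV) (config D \<omega> \<inter> A)"
proof -
  have "A \<subseteq> Y" using assms by (auto simp: sets_restrict_space_iff)
  then have *: "(\<lambda>x. x) -` A \<inter> space (count_space (config D \<omega> \<inter> Y)) = config D \<omega> \<inter> A"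
    by auto
  have "emeasure (decode D Y \<omega>) A = emeasure (count_space (config D \<omega> \<inter> Y)) (config D \<omega> \<inter> A)"
    unfolding decode_def *[symmetric] using assms by (intro emeasure_distr) (auto simp: space_restrict_space)
  also have "\<dots> = emeasure (count_space UNIV) (config D \<omega> \<inter> A)"
    using \<open>A \<subseteq> Y\<close> by (subst (1 2) emeasure_count_space) auto
  finally show ?thesis .
qed

text \<open>Both sides count points of the same set \<open>config D \<omega>\<close>. A single code
  therefore yields a compatible family of measures.\<close>

lemma restrict_decode:
  assumes "Y \<in> sets borel" "Z \<in> sets borel" "Y \<subseteq> Z"
  shows "restrict_space (decode D Z \<omega>) Y = decode D Y \<omega>"
proof (rule measure_eqI)
  have sp: "space (decode D Z \<omega>) = Z"
    by (simp add: decode_def space_restrict_space)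
  have Y: "Y \<inter> space (decode D Z \<omega>) \<in> sets (decode D Z \<omega>)"
    using assms by (simp add: sp sets_restrict_space_iff inf.absorb1)
  show eq: "sets (restrict_space (decode D Z \<omega>) Y) = sets (decode D Y \<omega>)"
    using assms sets_restrict_space_cong[OF sets_decode[of D Z \<omega>], of Y]
    by (simp add: sets_restrict_restrict_space inf.absorb2)
  fix A assume "A \<in> sets (restrict_space (decode D Z \<omega>) Y)"
  then have A: "A \<in> sets (restrict_space borel Y)" "A \<in> sets (restrict_space borel Z)" "A \<subseteq> Y"
    using assms unfolding eq by (auto simp: sets_restrict_space_iff)
  then show "emeasure (restrict_space (decode D Z \<omega>) Y) A = emeasure (decode D Y \<omega>) A"
    using Y assms by (simp add: emeasure_restrict_space emeasure_decode)
qed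

lemma config_Int_piece:
  assumes "disjoint_family D"
  shows "config D \<omega> \<inter> D p = (if finite (flagged_points D \<omega> p) then flagged_points D \<omega> p else {})"
proof -
  have "flagged_points D \<omega> q \<inter> D p = (if q = p then flagged_points D \<omega> p else {})" for q
    using flagged_points_subset[of D \<omega> q] assms by (auto simp: disjoint_family_on_def)
  moreover have "config D \<omega> \<inter> D p =
      (\<Union>q\<in>{q. finite (flagged_points D \<omega> q)}. flagged_points D \<omega> q \<inter> D p)"
    unfolding config_def by blast
  ultimately have "config D \<omega> \<inter> D p =
      (\<Union>q\<in>{q. finite (flagged_points D \<omega> q)}. if q = p then flagged_points D \<omega> p else {})"
    by (simp only:)
  then show ?thesis by auto
qed

lemma emeasure_config_suminf:
  assumes "disjoint_family D" "(\<Union>p. D p) = UNIV"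
  shows "emeasure (count_space UNIV) (config D \<omega> \<inter> A) =
    (\<Sum>p. emeasure (count_space UNIV) (config D \<omega> \<inter> D p \<inter> A))"
proof -
  have "(\<Sum>p. emeasure (count_space UNIV) (config D \<omega> \<inter> D p \<inter> A)) =
      emeasure (count_space UNIV) (\<Union>p. config D \<omega> \<inter> D p \<inter> A)"
    using assms(1) by (intro suminf_emeasure) (auto simp: disjoint_family_on_def)
  also have "(\<Union>p. config D \<omega> \<inter> D p \<inter> A) = config D \<omega> \<inter> A" using assms(2) by auto
  finally show ?thesis ..
qed

text \<open>A bounded subset of \<open>Y\<close> meets finitely many pieces, and each piece carries
  finitely many points because the infinite ones were discarded. Simplicity holds since a set of
  points is counted, without multiplicities.\<close>

lemma decode_in_counting_measures:
  fixes Y :: "'a::polish_space set"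
  assumes D: "disjoint_family D" "(\<Union>p. D p) = UNIV" and Y: "Y \<in> sets borel"
    and fin: "\<And>B. Metric_space.mbounded UNIV d B \<Longrightarrow> B \<subseteq> Y \<Longrightarrow> finite {p. D p \<inter> B \<noteq> {}}"
  shows "decode D Y \<omega> \<in> counting_measures d Y"
proof -
  have fin': "finite (config D \<omega> \<inter> B)" if B: "Metric_space.mbounded UNIV d B" "B \<subseteq> Y" for B
  proof (rule finite_subset)
    show "config D \<omega> \<inter> B \<subseteq> (\<Union>p\<in>{p. D p \<inter> B \<noteq> {}}. config D \<omega> \<inter> D p)"
      using D(2) by blast
    show "finite (\<Union>p\<in>{p. D p \<inter> B \<noteq> {}}. config D \<omega> \<inter> D p)"
      using fin[OF B] by (auto simp: config_Int_piece[OF D(1)])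
  qed
  have "emeasure (decode D Y \<omega>) B \<in> range of_nat \<union> {\<infinity>}" for B
  proof (cases "B \<in> sets (decode D Y \<omega>)")
    case True
    then show ?thesis using Y by (auto simp: emeasure_decode emeasure_count_space)
  next
    case False
    then show ?thesis by (auto simp: emeasure_notin_sets intro!: image_eqI[where x=0])
  qed
  moreover have "emeasure (decode D Y \<omega>) {y} \<le> 1" if "y \<in> Y" for y
  proof -
    have "{y} \<in> sets (restrict_space borel Y)" using that Y by (auto simp: sets_restrict_space_iff)
    moreover have "emeasure (count_space UNIV) (config D \<omega> \<inter> {y}) \<le> emeasure (count_space UNIV) {y}"
      by (intro emeasure_mono) auto
    ultimately show ?thesis using Y by (simp add: emeasure_decode)
  qed
  moreover have "emeasure (decode D Y \<omega>) B < \<infinity>"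
    if "B \<in> sets (decode D Y \<omega>)" "Metric_space.mbounded UNIV d B" for B
  proof -
    have "B \<subseteq> Y" using that(1) Y by (simp add: sets_restrict_space_iff)
    then show ?thesis using fin' that Y by (simp add: emeasure_decode of_nat_less_top)
  qed
  ultimately show ?thesis
    using sets_decode[of D Y \<omega>] unfolding counting_measures_def by blast
qed

text \<open>Different indices may flag the same point, so the number of distinct points is written
  as a sum over first occurrences. Each term is an event in finitely many coordinates, and equality
  of two coordinates is measurable in a Polish space.\<close>

lemma measurable_emeasure_flagged_points:
  fixes D :: "nat \<Rightarrow> 'a::polish_space set"
  assumes [measurable]: "A \<in> sets borel" "D p \<in> sets borel"
  shows "(\<lambda>\<omega>. emeasure (count_space UNIV) (flagged_points D \<omega> p \<inter> A)) \<in>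
    borel_measurable (Pi\<^sub>M UNIV (\<lambda>_. borel))"
proof -
  have *: "flagged_points D \<omega> p \<inter> A =
      {fst (\<omega> (p, i)) | i. snd (\<omega> (p, i)) = 1 \<and> fst (\<omega> (p, i)) \<in> D p \<inter> A}" for \<omega>
    by (auto simp: flagged_points_def)
  let ?M = "Pi\<^sub>M UNIV (\<lambda>_. borel) :: (nat \<times> nat \<Rightarrow> 'a \<times> real) measure"
  have fst_m: "(\<lambda>\<omega>. fst (\<omega> j)) \<in> borel_measurable ?M"
    and snd_m: "(\<lambda>\<omega>. snd (\<omega> j)) \<in> borel_measurable ?M" for j
    by (rule measurable_compose[OF measurable_component_singleton[OF UNIV_I]];
        intro borel_measurable_continuous_onI continuous_intros)+
  have [measurable]: "Measurable.pred ?M (\<lambda>\<omega>. fst (\<omega> j) = fst (\<omega> k))" for j k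
    using measurable_equality_set[OF fst_m fst_m] by (simp add: pred_def)
  have [measurable]: "Measurable.pred ?M (\<lambda>\<omega>. snd (\<omega> j) = 1)" for j
    using measurable_equality_set[OF snd_m measurable_const] by (simp add: pred_def)
  have [measurable]: "Measurable.pred ?M (\<lambda>\<omega>. fst (\<omega> j) \<in> D p \<inter> A)" for j
    by (rule pred_sets2[OF sets.Int[OF assms(2,1)] fst_m])
  define first where "first i \<omega> \<longleftrightarrow> (snd (\<omega> (p, i)) = 1 \<and> fst (\<omega> (p, i)) \<in> D p \<inter> A) \<and>
      (\<forall>k<i. \<not> ((snd (\<omega> (p, k)) = 1 \<and> fst (\<omega> (p, k)) \<in> D p \<inter> A) \<and> fst (\<omega> (p, k)) = fst (\<omega> (p, i))))"
    for i and \<omega> :: "nat \<times> nat \<Rightarrow> 'a \<times> real"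
  have [measurable]: "Measurable.pred ?M (first i)" for i
    unfolding first_def by measurable
  have "emeasure (count_space UNIV) (flagged_points D \<omega> p \<inter> A) = (\<Sum>i. if first i \<omega> then 1 else 0)" for \<omega>
    unfolding * emeasure_count_space_range first_def of_bool_def ..
  then show ?thesis by simp
qed

lemma measurable_decode:
  fixes D :: "nat \<Rightarrow> 'a::polish_space set"
  assumes D: "disjoint_family D" "(\<Union>p. D p) = UNIV" "\<And>p. D p \<in> sets borel" and Y: "Y \<in> sets borel"
    and fin: "\<And>B. Metric_space.mbounded UNIV d B \<Longrightarrow> B \<subseteq> Y \<Longrightarrow> finite {p. D p \<inter> B \<noteq> {}}"
  shows "decode D Y \<in> Pi\<^sub>M UNIV (\<lambda>_. borel) \<rightarrow>\<^sub>M counting_algebra d Y"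
proof (rule measurable_counting_algebraI)
  show "decode D Y \<omega> \<in> counting_measures d Y" for \<omega>
    using decode_in_counting_measures[OF D(1,2) Y fin] .
  fix A assume A: "A \<in> sets (restrict_space borel Y)"
  then have [measurable]: "A \<in> sets borel" using Y by (auto simp: sets_restrict_space_iff)
  \<comment> \<open>Discarding infinite pieces is rewritten as a test whether a counting measure is
    finite. Intersecting with \<open>UNIV\<close> brings that test into the form already shown
    measurable.\<close>
  have *: "emeasure (count_space UNIV) (config D \<omega> \<inter> D p \<inter> A) =
    (if emeasure (count_space UNIV) (flagged_points D \<omega> p \<inter> UNIV) < \<infinity>
     then emeasure (count_space UNIV) (flagged_points D \<omega> p \<inter> A) else 0)" for \<omega> p
    by (simp add: config_Int_piece[OF D(1)] of_nat_less_top)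
  note [measurable] = measurable_emeasure_flagged_points[where D=D]  D(3)
  show "(\<lambda>\<omega>. emeasure (decode D Y \<omega>) A) \<in> borel_measurable (Pi\<^sub>M UNIV (\<lambda>_. borel))"
    unfolding emeasure_decode[OF Y A] emeasure_config_suminf[OF D(1,2)] * by measurable
qed

section \<open>Coding: recovering a measure from its code\<close>

text \<open>A set of nonzero mass is measurable, and its mass is the number of its atoms.\<close>

lemma counting_measure_unique_atom:
  fixes Y :: "'a::polish_space set"
  assumes \<xi>: "\<xi> \<in> counting_measures d Y" and Y: "Y \<in> sets borel" and B: "emeasure \<xi> B = 1"
  obtains x where "{y \<in> B. emeasure \<xi> {y} = 1} = {x}" "(THE x. x \<in> B \<and> emeasure \<xi> {x} = 1) = x"
    "x \<in> B" "emeasure \<xi> {x} = 1"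
proof -
  have "B \<in> sets \<xi>" using B emeasure_notin_sets by fastforce
  with counting_measure_eq_card_atoms[OF \<xi> Y this] B
  have "card {y \<in> B. emeasure \<xi> {y} = 1} = 1" by simp
  then obtain x where x: "{y \<in> B. emeasure \<xi> {y} = 1} = {x}" by (auto simp: card_1_singleton_iff)
  show thesis using x by (intro that[OF x] the_equality) auto
qed

text \<open>A flagged point is the only atom of some \<open>D p \<inter> U i\<close>. Conversely,
  \<open>D p\<close> has finitely many atoms, so some basic open set separates a given atom from all
  the others and thereby flags it.\<close>

lemma flagged_points_code:
  fixes Y :: "'a::polish_space set"
  assumes \<xi>: "\<xi> \<in> counting_measures d Y" and Y: "Y \<in> sets borel"
    and D: "D p \<in> sets \<xi>" "emeasure \<xi> (D p) < \<infinity>"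
    and U: "topological_basis (range U)"
  shows "flagged_points D (code D U \<xi>) p = {x \<in> D p. emeasure \<xi> {x} = 1}"
proof (intro equalityI subsetI)
  fix x assume "x \<in> flagged_points D (code D U \<xi>) p"
  then obtain i where i: "x = fst (code D U \<xi> (p, i))" "snd (code D U \<xi> (p, i)) = 1"
    by (auto simp: flagged_points_def)
  then have 1: "emeasure \<xi> (D p \<inter> U i) = 1"
    by (auto simp: code_def Let_def split: if_splits)
  obtain y where "(THE x. x \<in> D p \<inter> U i \<and> emeasure \<xi> {x} = 1) = y" "y \<in> D p \<inter> U i" "emeasure \<xi> {y} = 1"
    using counting_measure_unique_atom[OF \<xi> Y 1] .
  with i 1 show "x \<in> {x \<in> D p. emeasure \<xi> {x} = 1}" by (simp add: code_def Let_def)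
next
  fix x assume x: "x \<in> {x \<in> D p. emeasure \<xi> {x} = 1}"
  let ?F = "{x \<in> D p. emeasure \<xi> {x} = 1}"
  have "finite ?F" using counting_measure_eq_card_atoms[OF \<xi> Y D] by simp
  then have "open (- (?F - {x}))" by (intro open_Compl finite_imp_closed) auto
  then obtain i where i: "x \<in> U i" "U i \<subseteq> - (?F - {x})"
    using topological_basisE[OF U, of "- (?F - {x})" x] by auto
  have "open (U i)" using topological_basis_open[OF U] by auto
  then have Us: "D p \<inter> U i \<in> sets \<xi>" using D by (auto simp: sets_counting_measure[OF \<xi> Y])
  have "emeasure \<xi> (D p \<inter> U i) < \<infinity>"
    using emeasure_mono[OF Int_lower1 D(1)] D(2) by (rule le_less_trans)
  then have "emeasure \<xi> (D p \<inter> U i) = emeasure (count_space UNIV) {y \<in> D p \<inter> U i. emeasure \<xi> {y} = 1}"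
    using counting_measure_eq_card_atoms(2)[OF \<xi> Y Us] by simp
  also have eq: "{y \<in> D p \<inter> U i. emeasure \<xi> {y} = 1} = {x}" using i x by auto
  finally have 1: "emeasure \<xi> (D p \<inter> U i) = 1" by simp
  have "(THE y. y \<in> D p \<inter> U i \<and> emeasure \<xi> {y} = 1) = x"
    using eq by (intro the_equality) auto
  then have "code D U \<xi> (p, i) = (x, 1)" using 1 by (simp add: code_def)
  then show "x \<in> flagged_points D (code D U \<xi>) p"
    using x unfolding flagged_points_def by (auto intro!: exI[where x=i])
qed

text \<open>A subset of \<open>D p\<close> with mass 1 would be measurable, hence contained in
  \<open>Y\<close>, hence empty.\<close>

lemma flagged_points_code_outside:
  assumes "\<xi> \<in> counting_measures d Y" "Y \<in> sets borel" "D p \<inter> Y = {}"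
  shows "flagged_points D (code D U \<xi>) p = {}"
proof -
  have "emeasure \<xi> (D p \<inter> U i) \<noteq> 1" for i
  proof
    assume 1: "emeasure \<xi> (D p \<inter> U i) = 1"
    then have "D p \<inter> U i \<in> sets \<xi>" using emeasure_notin_sets by fastforce
    then have "D p \<inter> U i \<subseteq> Y" using assms by (simp add: sets_counting_measure)
    then have "D p \<inter> U i = {}" using assms by auto
    then show False using 1 by simp
  qed
  then show ?thesis by (auto simp: flagged_points_def code_def)
qed

text \<open>Both measures are compared on each piece and summed. On a piece meeting \<open>Y\<close>
  the flagged points are exactly the finitely many atoms, and these determine \<open>\<xi>\<close>
  there; the other pieces contribute nothing to either side.\<close>

lemma decode_code:
  fixes Y :: "'a::polish_space set"
  assumes D: "disjoint_family D" "(\<Union>p. D p) = UNIV" and Y: "Y \<in> sets borel"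
    and \<xi>: "\<xi> \<in> counting_measures d Y"
    and D': "\<And>p. D p \<inter> Y \<noteq> {} \<Longrightarrow> D p \<in> sets \<xi> \<and> emeasure \<xi> (D p) < \<infinity>"
    and U: "topological_basis (range U)"
  shows "decode D Y (code D U \<xi>) = \<xi>"
proof (rule measure_eqI)
  show eq: "sets (decode D Y (code D U \<xi>)) = sets \<xi>"
    using \<xi> by (simp add: counting_measures_def)
  fix A assume "A \<in> sets (decode D Y (code D U \<xi>))"
  then have A: "A \<in> sets (restrict_space borel Y)" "A \<in> sets \<xi>" using eq by auto
  have piece: "A \<inter> D p \<in> sets \<xi> \<and>
      emeasure (count_space UNIV) (config D (code D U \<xi>) \<inter> D p \<inter> A) = emeasure \<xi> (A \<inter> D p)" for p
  proof (cases "D p \<inter> Y = {}")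
    case True
    then have "A \<inter> D p = {}" using A(2) by (auto simp: sets_counting_measure[OF \<xi> Y])
    then show ?thesis
      using flagged_points_code_outside[OF \<xi> Y, where D=D and U=U] True by (simp add: config_Int_piece[OF D(1)])
  next
    case False
    note Dp = D'[OF this, THEN conjunct1] D'[OF this, THEN conjunct2]
    have s: "A \<inter> D p \<in> sets \<xi>" using A Dp by auto
    have f: "emeasure \<xi> (A \<inter> D p) < \<infinity>"
      using emeasure_mono[OF Int_lower2 Dp(1)] Dp(2) by (rule le_less_trans)
    have "config D (code D U \<xi>) \<inter> D p = {x \<in> D p. emeasure \<xi> {x} = 1}"
      using counting_measure_eq_card_atoms(1)[OF \<xi> Y Dp]
      by (simp add: config_Int_piece[OF D(1)] flagged_points_code[where D=D and p=p, OF \<xi> Y Dp U])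
    then have "config D (code D U \<xi>) \<inter> D p \<inter> A = {x \<in> A \<inter> D p. emeasure \<xi> {x} = 1}" by auto
    then show ?thesis using counting_measure_eq_card_atoms(2)[OF \<xi> Y s f] s by simp
  qed
  have "emeasure (decode D Y (code D U \<xi>)) A = (\<Sum>p. emeasure \<xi> (A \<inter> D p))"
    using piece by (simp add: emeasure_decode[OF Y A(1)] emeasure_config_suminf[OF D])
  also have "\<dots> = emeasure \<xi> (\<Union>p. A \<inter> D p)"
    using piece D(1) by (intro suminf_emeasure) (auto simp: disjoint_family_on_def)
  also have "(\<Union>p. A \<inter> D p) = A" using D(2) by auto
  finally show "emeasure (decode D Y (code D U \<xi>)) A = emeasure \<xi> A" .
qed

text \<open>The recorded atom lies in \<open>C\<close> iff \<open>\<xi> (B \<inter> C) = 1\<close>,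
  so the point chosen by \<open>THE\<close> is controlled by evaluation maps. If \<open>B\<close> is
  not contained in \<open>Y\<close>, it has mass 0 under every \<open>\<xi>\<close> and the
  coordinate is constant.\<close>

lemma measurable_code:
  fixes Y :: "'a::polish_space set"
  assumes Y: "Y \<in> sets borel" and D: "D (fst j) \<inter> U (snd j) \<in> sets borel"
  shows "(\<lambda>\<xi>. code D U \<xi> j) \<in> borel_measurable (counting_algebra d Y)"
proof (cases "D (fst j) \<inter> U (snd j) \<subseteq> Y")
  case True
  define B where "B = D (fst j) \<inter> U (snd j)"
  define pt where "pt \<xi> = (if emeasure \<xi> B = 1 then THE x. x \<in> B \<and> emeasure \<xi> {x} = 1 else undefined)" for \<xi> :: "'a measure"
  define fl where "fl \<xi> = (if emeasure \<xi> B = 1 then 1 else 0 :: real)" for \<xi> :: "'a measure"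
  have B: "B \<in> sets (restrict_space borel Y)"
    using True D Y by (auto simp: B_def sets_restrict_space_iff)
  note [measurable] = measurable_emeasure_counting_algebra[OF B]
  have "pt \<in> borel_measurable (counting_algebra d Y)"
  proof (rule measurableI)
    fix C :: "'a set" assume "C \<in> sets borel"
    then have BC: "B \<inter> C \<in> sets (restrict_space borel Y)"
      using B Y by (auto simp: sets_restrict_space_iff)
    note [measurable] = measurable_emeasure_counting_algebra[OF BC]
    have "pt \<xi> \<in> C \<longleftrightarrow> (if emeasure \<xi> B = 1 then emeasure \<xi> (B \<inter> C) = 1 else undefined \<in> C)"
      if \<xi>: "\<xi> \<in> counting_measures d Y" for \<xi>
    proof (cases "emeasure \<xi> B = 1")
      case 1: True
      obtain x where x: "{y \<in> B. emeasure \<xi> {y} = 1} = {x}" "(THE x. x \<in> B \<and> emeasure \<xi> {x} = 1) = x"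
        using counting_measure_unique_atom[OF \<xi> Y 1] .
      then have pt: "pt \<xi> = x" using 1 by (simp add: pt_def)
      have s: "B \<inter> C \<in> sets \<xi>" "B \<in> sets \<xi>"
        using B BC \<xi> by (auto simp: counting_measures_def)
      have "emeasure \<xi> (B \<inter> C) \<le> 1" using emeasure_mono[OF Int_lower1 s(2), of C] unfolding 1 .
      then have "emeasure \<xi> (B \<inter> C) < \<infinity>" by (rule le_less_trans) simp
      then have "emeasure \<xi> (B \<inter> C) = emeasure (count_space UNIV) {y \<in> B \<inter> C. emeasure \<xi> {y} = 1}"
        by (rule counting_measure_eq_card_atoms(2)[OF \<xi> Y s(1)])
      also have "{y \<in> B \<inter> C. emeasure \<xi> {y} = 1} = (if x \<in> C then {x} else {})" using x(1) by auto
      finally show ?thesis using 1 pt by simp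
    qed (simp add: pt_def)
    then have "pt -` C \<inter> space (counting_algebra d Y) = {\<xi> \<in> space (counting_algebra d Y).
        if emeasure \<xi> B = 1 then emeasure \<xi> (B \<inter> C) = 1 else undefined \<in> C}" by auto
    also have "\<dots> \<in> sets (counting_algebra d Y)" by measurable
    finally show "pt -` C \<inter> space (counting_algebra d Y) \<in> sets (counting_algebra d Y)" .
  qed simp
  moreover have "fl \<in> borel_measurable (counting_algebra d Y)"
    unfolding fl_def by measurable
  ultimately have "(\<lambda>\<xi>. (pt \<xi>, fl \<xi>)) \<in> borel_measurable (counting_algebra d Y)"
    by (rule borel_measurable_Pair)
  also have "(\<lambda>\<xi>. (pt \<xi>, fl \<xi>)) = (\<lambda>\<xi>. code D U \<xi> j)"
    by (auto simp: pt_def fl_def code_def B_def fun_eq_iff)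
  finally show ?thesis .
next
  case False
  have "code D U \<xi> j = (undefined, 0)" if "\<xi> \<in> counting_measures d Y" for \<xi>
  proof -
    have "D (fst j) \<inter> U (snd j) \<notin> sets \<xi>"
      using False by (simp add: sets_counting_measure[OF that Y])
    then have "emeasure \<xi> (D (fst j) \<inter> U (snd j)) = 0"
      by (rule emeasure_notin_sets)
    then show ?thesis by (simp add: code_def Let_def)
  qed
  then have "(\<lambda>\<xi>. code D U \<xi> j) \<in> borel_measurable (counting_algebra d Y) \<longleftrightarrow>
      (\<lambda>_. (undefined, 0) :: 'a \<times> real) \<in> borel_measurable (counting_algebra d Y)"
    unfolding space_counting_algebra[symmetric] by (rule measurable_cong)
  then show ?thesis by (simp only: borel_measurable_const)
qed

text \<open>The coordinate only consults masses of subsets of \<open>Y\<close>, which restriction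
  preserves. This makes the laws of codes consistent across levels.\<close>

lemma code_restrict_space:
  assumes "Y \<in> sets borel" "Z \<in> sets borel" "Y \<subseteq> Z" "\<xi> \<in> counting_measures d Z"
    and D: "D (fst j) \<inter> U (snd j) \<subseteq> Y"
  shows "code D U (restrict_space \<xi> Y) j = code D U \<xi> j"
proof -
  have "Y \<inter> space \<xi> \<in> sets \<xi>"
    using assms by (auto simp: sets_counting_measure space_counting_measure[of \<xi> d Z])
  then have em: "emeasure (restrict_space \<xi> Y) A = emeasure \<xi> A" if "A \<subseteq> Y" for A
    using that by (rule emeasure_restrict_space)
  have "(\<lambda>x. x \<in> D (fst j) \<inter> U (snd j) \<and> emeasure (restrict_space \<xi> Y) {x} = 1) =
     (\<lambda>x. x \<in> D (fst j) \<inter> U (snd j) \<and> emeasure \<xi> {x} = 1)"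
    using D em by (intro ext) auto
  then show ?thesis unfolding code_def Let_def em[OF D] by (simp only:)
qed

text \<open>Flagged points stay in their piece, so a piece missing \<open>Y\<close> cannot
  contribute. Hence the law of \<open>decode D (X n)\<close> can be computed from the coordinates of
  level at most \<open>n\<close>.\<close>

lemma decode_cong:
  assumes "\<And>p i. D p \<inter> Y \<noteq> {} \<Longrightarrow> \<omega> (p, i) = \<omega>' (p, i)"
  shows "decode D Y \<omega> = decode D Y \<omega>'"
proof -
  have eq: "flagged_points D \<omega> p = flagged_points D \<omega>' p" if "D p \<inter> Y \<noteq> {}" for p
    using assms[OF that] by (simp add: flagged_points_def)
  have restr: "config D \<eta> \<inter> Y =
      (\<Union>p\<in>{p. D p \<inter> Y \<noteq> {} \<and> finite (flagged_points D \<eta> p)}. flagged_points D \<eta> p \<inter> Y)" for \<eta>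
    using flagged_points_subset[of D \<eta>] unfolding config_def by blast
  have "config D \<omega> \<inter> Y = config D \<omega>' \<inter> Y"
    unfolding restr by (rule SUP_cong) (auto simp: eq cong: conj_cong)
  then show ?thesis by (simp add: decode_def)
qed

section \<open>Transport of the law of codes back to measures\<close>

text \<open>On the coordinates of level at most \<open>n\<close>, the law \<open>L\<close> agrees
  with the law of the code under \<open>\<mu> n\<close>. Decoding on \<open>X n\<close> uses only
  these coordinates and inverts the code, so it carries \<open>L\<close> to
  \<open>\<mu> n\<close>.\<close>

lemma distr_decode_eq:
  fixes D U :: "nat \<Rightarrow> 'a::polish_space set" and X :: "nat \<Rightarrow> 'a set"
  assumes X: "\<And>n. 1 \<le> n \<Longrightarrow> X n \<in> sets borel" "\<And>n m. 1 \<le> n \<Longrightarrow> n \<le> m \<Longrightarrow> X n \<subseteq> X m"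
    and D: "disjoint_family D" "(\<Union>p. D p) = UNIV" "\<And>p. D p \<in> sets borel"
    and bounded: "\<And>p. Metric_space.mbounded UNIV d (D p)"
    and fin: "\<And>n B. 1 \<le> n \<Longrightarrow> Metric_space.mbounded UNIV d B \<Longrightarrow> B \<subseteq> X n \<Longrightarrow> finite {p. D p \<inter> B \<noteq> {}}"
    and lev: "\<And>n p. 1 \<le> n \<Longrightarrow> lev p \<le> n \<Longrightarrow> D p \<subseteq> X n" "\<And>n p. 1 \<le> n \<Longrightarrow> n < lev p \<Longrightarrow> D p \<inter> X n = {}"
    and U: "topological_basis (range U)"
    and \<mu>: "projective_system d X \<mu>"
  obtains L where "prob_space L" "sets L = sets (Pi\<^sub>M UNIV (\<lambda>_. borel))"
    "\<And>n. 1 \<le> n \<Longrightarrow> distr L (counting_algebra d (X n)) (decode D (X n)) = \<mu> n"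
proof -
  have prob: "prob_space (\<mu> n)" and sets_\<mu>: "sets (\<mu> n) = sets (counting_algebra d (X n))" if "1 \<le> n" for n
    using \<mu> that by (auto simp: projective_system_def point_process_def)
  have space_\<mu>: "space (\<mu> n) = counting_measures d (X n)" if "1 \<le> n" for n
    using sets_eq_imp_space_eq[OF sets_\<mu>[OF that]] by simp
  have \<mu>_distr: "\<mu> n = distr (\<mu> m) (counting_algebra d (X n)) (\<lambda>\<xi>. restrict_space \<xi> (X n))"
    if "1 \<le> n" "n \<le> m" for n m
    using \<mu> that by (auto simp: projective_system_def)
  have U_open: "open (U i)" for i
    using topological_basis_open[OF U] by auto
  have code_m: "(\<lambda>\<xi>. code D U \<xi> j) \<in> borel_measurable (counting_algebra d (X n))" if "1 \<le> n" for n j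
    using D(3) U_open X(1)[OF that] by (intro measurable_code) auto
  have code_\<mu>: "(\<lambda>\<xi>. code D U \<xi> j) \<in> borel_measurable (\<mu> n)" if "1 \<le> n" for n j
    using code_m[OF that] by (simp cong: measurable_cong_sets add: sets_\<mu>[OF that])
  define lv where "lv j = lev (fst j)" for j :: "nat \<times> nat"
  have cons: "distr (\<mu> n) (Pi\<^sub>M J (\<lambda>_. borel)) (\<lambda>\<xi>. restrict (code D U \<xi>) J) =
      distr (\<mu> m) (Pi\<^sub>M J (\<lambda>_. borel)) (\<lambda>\<xi>. restrict (code D U \<xi>) J)"
    if n: "1 \<le> n" and nm: "n \<le> m" and J: "\<forall>j\<in>J. lv j \<le> n" for n m J
  proof -
    have m: "1 \<le> m" using n nm by simp
    have "distr (\<mu> n) (Pi\<^sub>M J (\<lambda>_. borel)) (\<lambda>\<xi>. restrict (code D U \<xi>) J) =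
      distr (distr (\<mu> m) (counting_algebra d (X n)) (\<lambda>\<xi>. restrict_space \<xi> (X n)))
        (Pi\<^sub>M J (\<lambda>_. borel)) (\<lambda>\<xi>. restrict (code D U \<xi>) J)"
      using \<mu>_distr[OF n nm] by simp
    also have "\<dots> = distr (\<mu> m) (Pi\<^sub>M J (\<lambda>_. borel)) (\<lambda>\<xi>. restrict (code D U (restrict_space \<xi> (X n))) J)"
    proof (subst distr_distr)
      show "(\<lambda>\<xi>. restrict (code D U \<xi>) J) \<in> counting_algebra d (X n) \<rightarrow>\<^sub>M Pi\<^sub>M J (\<lambda>_. borel)"
        using code_m[OF n] by (intro measurable_restrict)
      show "(\<lambda>\<xi>. restrict_space \<xi> (X n)) \<in> \<mu> m \<rightarrow>\<^sub>M counting_algebra d (X n)"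
        using measurable_restrict_counting_algebra[OF X(1)[OF n] X(1)[OF m] X(2)[OF n nm]]
        by (simp cong: measurable_cong_sets add: sets_\<mu>[OF m])
    qed (simp add: o_def)
    also have "\<dots> = distr (\<mu> m) (Pi\<^sub>M J (\<lambda>_. borel)) (\<lambda>\<xi>. restrict (code D U \<xi>) J)"
    proof (rule distr_cong)
      fix \<xi> assume \<xi>: "\<xi> \<in> space (\<mu> m)"
      \<comment> \<open>Pieces of level at most \<open>n\<close> lie in \<open>X n\<close>, so these
        coordinates do not notice the restriction.\<close>
      have "code D U (restrict_space \<xi> (X n)) j = code D U \<xi> j" if "j \<in> J" for j
      proof (rule code_restrict_space[OF X(1)[OF n] X(1)[OF m] X(2)[OF n nm]])
        show "\<xi> \<in> counting_measures d (X m)" using \<xi> space_\<mu>[OF m] by simp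
        show "D (fst j) \<inter> U (snd j) \<subseteq> X n"
          using lev(1)[OF n, of "fst j"] J that by (auto simp: lv_def)
      qed
      then show "restrict (code D U (restrict_space \<xi> (X n))) J = restrict (code D U \<xi>) J"
        by (rule restrict_ext)
    qed simp_all
    finally show ?thesis .
  qed
  obtain L where L: "prob_space L" "sets L = sets (Pi\<^sub>M UNIV (\<lambda>_. borel))"
    and law: "\<And>n. 1 \<le> n \<Longrightarrow> distr L (Pi\<^sub>M {j. lv j \<le> n} (\<lambda>_. borel)) (\<lambda>\<omega>. restrict \<omega> {j. lv j \<le> n}) =
       distr (\<mu> n) (Pi\<^sub>M {j. lv j \<le> n} (\<lambda>_. borel)) (\<lambda>\<xi>. restrict (code D U \<xi>) {j. lv j \<le> n})"
    by (rule kolmogorov_extension_levels[of \<mu> "code D U" lv, OF prob code_\<mu> cons]) auto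
  have "distr L (counting_algebra d (X n)) (decode D (X n)) = \<mu> n" if n: "1 \<le> n" for n
  proof -
    let ?I = "{j. lv j \<le> n}" and ?N = "counting_algebra d (X n)"
    let ?PI = "Pi\<^sub>M ?I (\<lambda>_. borel) :: (nat \<times> nat \<Rightarrow> 'a \<times> real) measure"
    have restr: "decode D (X n) (restrict \<omega> ?I) = decode D (X n) \<omega>" for \<omega>
    proof (rule decode_cong)
      fix p i assume "D p \<inter> X n \<noteq> {}"
      then have "lev p \<le> n" using lev(2)[OF n, of p] by (cases "lev p \<le> n") auto
      then show "restrict \<omega> ?I (p, i) = \<omega> (p, i)" by (simp add: lv_def)
    qed
    have dec: "decode D (X n) \<in> Pi\<^sub>M UNIV (\<lambda>_. borel) \<rightarrow>\<^sub>M ?N"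
      using fin[OF n] by (intro measurable_decode D X n)
    \<comment> \<open>\<open>restrict\<close> fills the coordinates outside \<open>?I\<close> with
      \<open>undefined\<close>. A partial code thus becomes a full one, to which the measurability
      of \<open>decode\<close> applies.\<close>
    have ext: "(\<lambda>\<omega>. restrict \<omega> ?I) \<in> ?PI \<rightarrow>\<^sub>M Pi\<^sub>M UNIV (\<lambda>_. borel)"
    proof (rule measurable_PiM_single')
      show "(\<lambda>\<omega>. restrict \<omega> ?I j) \<in> ?PI \<rightarrow>\<^sub>M borel" for j
        by (cases "j \<in> ?I") (simp_all add: restrict_def)
    qed auto
    have dec': "(\<lambda>\<omega>. decode D (X n) (restrict \<omega> ?I)) \<in> ?PI \<rightarrow>\<^sub>M ?N"
      by (rule measurable_compose[OF ext dec])
    have rL: "(\<lambda>\<omega>. restrict \<omega> ?I) \<in> L \<rightarrow>\<^sub>M ?PI"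
      using L(2) by (simp cong: measurable_cong_sets add: measurable_restrict_subset)
    have rc: "(\<lambda>\<xi>. restrict (code D U \<xi>) ?I) \<in> \<mu> n \<rightarrow>\<^sub>M ?PI"
      using code_\<mu>[OF n] by (intro measurable_restrict)
    have "distr L ?N (decode D (X n)) = distr (distr L ?PI (\<lambda>\<omega>. restrict \<omega> ?I)) ?N (\<lambda>\<omega>. decode D (X n) (restrict \<omega> ?I))"
      unfolding distr_distr[OF dec' rL] by (simp add: o_def restr)
    also have "\<dots> = distr (\<mu> n) ?N (\<lambda>\<xi>. decode D (X n) (code D U \<xi>))"
      unfolding law[OF n] distr_distr[OF dec' rc] by (simp add: o_def restr)
    also have "\<dots> = distr (\<mu> n) (\<mu> n) (\<lambda>\<xi>. \<xi>)"
    proof (rule distr_cong)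
      fix \<xi> assume "\<xi> \<in> space (\<mu> n)"
      then have \<xi>: "\<xi> \<in> counting_measures d (X n)" using space_\<mu>[OF n] by simp
      have Dn: "D p \<in> sets \<xi> \<and> emeasure \<xi> (D p) < \<infinity>" if "D p \<inter> X n \<noteq> {}" for p
      proof -
        have "lev p \<le> n" using lev(2)[OF n, of p] that by (cases "lev p \<le> n") auto
        then have "D p \<in> sets \<xi>" using D(3) lev(1)[OF n] by (simp add: sets_counting_measure[OF \<xi> X(1)[OF n]])
        then show ?thesis using \<xi> bounded by (auto simp: counting_measures_def)
      qed
      show "decode D (X n) (code D U \<xi>) = \<xi>"
        by (rule decode_code[OF D(1,2) X(1)[OF n] \<xi> Dn U])
    qed (simp_all add: sets_\<mu>[OF n])
    also have "\<dots> = \<mu> n" by simp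
    finally show ?thesis .
  qed
  with L show thesis by (rule that)
qed

section \<open>Uniqueness\<close>

text \<open>The preimages under single maps \<open>f n\<close> form the generator. They are stable
  under intersection because \<open>h\<close> lifts two of them to the larger index. Hypothesis
  \<open>gen\<close> says, as a universal property, that \<open>N\<close> is the smallest
  \<sigma>-algebra making all \<open>f n\<close> measurable.\<close>

lemma prob_measure_eqI_projections:
  fixes f :: "nat \<Rightarrow> 'a \<Rightarrow> 'b"
  assumes A: "prob_space A" "sets A = sets N" and B: "prob_space B" "sets B = sets N"
    and f: "\<And>n. 1 \<le> n \<Longrightarrow> f n \<in> N \<rightarrow>\<^sub>M K n"
    and h: "\<And>n m. 1 \<le> n \<Longrightarrow> n \<le> m \<Longrightarrow> h n \<in> K m \<rightarrow>\<^sub>M K n"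
    and hf: "\<And>n m x. 1 \<le> n \<Longrightarrow> n \<le> m \<Longrightarrow> x \<in> space N \<Longrightarrow> h n (f m x) = f n x"
    and gen: "\<And>G. space G = space N \<Longrightarrow> (\<And>n. 1 \<le> n \<Longrightarrow> f n \<in> G \<rightarrow>\<^sub>M K n) \<Longrightarrow> (\<lambda>x. x) \<in> G \<rightarrow>\<^sub>M N"
    and eq: "\<And>n. 1 \<le> n \<Longrightarrow> distr A (K n) (f n) = distr B (K n) (f n)"
  shows "A = B"
proof (rule measure_eqI_generator_eq)
  let ?E = "{f n -` S \<inter> space N | n S. 1 \<le> n \<and> S \<in> sets (K n)}"
  have spaces: "space A = space N" "space B = space N"
    by (rule sets_eq_imp_space_eq[OF A(2)], rule sets_eq_imp_space_eq[OF B(2)])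
  have lift: "f n -` S \<inter> space N = f m -` (h n -` S \<inter> space (K m)) \<inter> space N"
    if "1 \<le> n" "n \<le> m" for n m S
    using hf[OF that] measurable_space[OF f[of m]] that by auto
  show "Int_stable ?E"
  proof (rule Int_stableI)
    fix P Q assume "P \<in> ?E" "Q \<in> ?E"
    then obtain n S m T where P: "P = f n -` S \<inter> space N" "1 \<le> n" "S \<in> sets (K n)"
      and Q: "Q = f m -` T \<inter> space N" "1 \<le> m" "T \<in> sets (K m)" by blast
    let ?k = "max n m"
    have "P \<inter> Q = f ?k -` ((h n -` S \<inter> space (K ?k)) \<inter> (h m -` T \<inter> space (K ?k))) \<inter> space N"
      unfolding P(1) Q(1) lift[OF P(2) max.cobounded1[of n m]] lift[OF Q(2) max.cobounded2[of m n]] by auto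
    moreover have "(h n -` S \<inter> space (K ?k)) \<inter> (h m -` T \<inter> space (K ?k)) \<in> sets (K ?k)"
      using P Q h[of n ?k] h[of m ?k] by (intro sets.Int measurable_sets) auto
    moreover have "1 \<le> ?k" using P by simp
    ultimately show "P \<inter> Q \<in> ?E" by blast
  qed
  show E: "?E \<subseteq> Pow (space N)" by auto
  define G where "G = sigma (space N) ?E"
  have G: "space G = space N" "sets G = sigma_sets (space N) ?E"
    unfolding G_def using E by (auto simp: space_measure_of_conv)
  have "f n \<in> G \<rightarrow>\<^sub>M K n" if "1 \<le> n" for n
  proof (rule measurableI)
    show "f n x \<in> space (K n)" if "x \<in> space G" for x
      using that measurable_space[OF f[OF \<open>1 \<le> n\<close>]] by (simp only: G)
    show "f n -` S \<inter> space G \<in> sets G" if "S \<in> sets (K n)" for S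
      unfolding G using that \<open>1 \<le> n\<close> by (intro sigma_sets.Basic) blast
  qed
  \<comment> \<open>For the \<sigma>-algebra generated by the preimages, measurability of the
    identity means that it contains \<open>sets N\<close>.\<close>
  then have id: "(\<lambda>x. x) \<in> G \<rightarrow>\<^sub>M N" by (rule gen[OF G(1)])
  have "sets N \<subseteq> sigma_sets (space N) ?E"
  proof
    fix S assume S: "S \<in> sets N"
    from measurable_sets[OF id S] show "S \<in> sigma_sets (space N) ?E"
      using sets.sets_into_space[OF S] by (simp add: G Int_absorb2)
  qed
  moreover have "?E \<subseteq> sets N" using f by (auto intro: measurable_sets)
  ultimately have gen': "sets N = sigma_sets (space N) ?E"
    using sets.sigma_sets_subset by blast
  show "sets A = sigma_sets (space N) ?E" using A(2) gen' by (rule trans)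
  show "sets B = sigma_sets (space N) ?E" using B(2) gen' by (rule trans)
  show "emeasure A P = emeasure B P" if "P \<in> ?E" for P
  proof -
    from that obtain n S where P: "P = f n -` S \<inter> space N" "1 \<le> n" "S \<in> sets (K n)"
      by (elim CollectE exE conjE)
    have "f n \<in> A \<rightarrow>\<^sub>M K n" "f n \<in> B \<rightarrow>\<^sub>M K n"
      using f[OF P(2)] unfolding measurable_cong_sets[OF A(2) refl] measurable_cong_sets[OF B(2) refl] by -
    then show ?thesis
      using arg_cong[OF eq[OF P(2)], where f="\<lambda>M. emeasure M S"] P(1,3)
      by (simp add: emeasure_distr spaces)
  qed
  \<comment> \<open>The whole space is itself in the generator, so a constant sequence of finite
    mass serves as the exhaustion.\<close>
  have "space N = f 1 -` space (K 1) \<inter> space N"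
    using measurable_space[OF f[of 1]] by auto
  then have "space N \<in> ?E" by (metis (mono_tags, lifting) le_refl mem_Collect_eq sets.top)
  then show "range (\<lambda>_::nat. space N) \<subseteq> ?E" by blast
  show "emeasure A (space N) \<noteq> \<infinity>"
    using prob_space.emeasure_space_1[OF A(1)] by (simp add: spaces)
qed auto

text \<open>The coordinate maps generate the trace of the product \<sigma>-algebra, and
  compatibility of the sequences makes the restriction maps act as transition maps between
  coordinates.\<close>

lemma is_projective_limit_unique:
  fixes X :: "nat \<Rightarrow> 'a::topological_space set"
  assumes X: "\<And>n. 1 \<le> n \<Longrightarrow> X n \<in> sets borel" "\<And>n m. 1 \<le> n \<Longrightarrow> n \<le> m \<Longrightarrow> X n \<subseteq> X m"
    and \<nu>: "is_projective_limit d X \<mu> \<nu>" "is_projective_limit d X \<mu> \<nu>'"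
  shows "\<nu> = \<nu>'"
proof (rule prob_measure_eqI_projections[where N="projective_limit_space d X" and f="\<lambda>n \<xi>. \<xi> n"
      and K="\<lambda>n. counting_algebra d (X n)" and h="\<lambda>n \<xi>. restrict_space \<xi> (X n)"])
  show "prob_space \<nu>" "sets \<nu> = sets (projective_limit_space d X)"
    "prob_space \<nu>'" "sets \<nu>' = sets (projective_limit_space d X)"
    using \<nu> by (simp_all add: is_projective_limit_def)
  show "(\<lambda>\<xi>. \<xi> n) \<in> projective_limit_space d X \<rightarrow>\<^sub>M counting_algebra d (X n)" if "1 \<le> n" for n
    unfolding projective_limit_space_def
    using that by (intro measurable_restrict_space1 measurable_component_singleton) simp
  show "(\<lambda>\<xi>. restrict_space \<xi> (X n)) \<in> counting_algebra d (X m) \<rightarrow>\<^sub>M counting_algebra d (X n)"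
    if "1 \<le> n" "n \<le> m" for n m
    using that by (intro measurable_restrict_counting_algebra X) auto
  show "restrict_space (\<xi> m) (X n) = \<xi> n"
    if "1 \<le> n" "n \<le> m" "\<xi> \<in> space (projective_limit_space d X)" for n m \<xi>
    using that by (simp add: projective_limit_space_def space_restrict_space)
  show "(\<lambda>\<xi>. \<xi>) \<in> G \<rightarrow>\<^sub>M projective_limit_space d X"
    if G: "space G = space (projective_limit_space d X)"
      "\<And>n. 1 \<le> n \<Longrightarrow> (\<lambda>\<xi>. \<xi> n) \<in> G \<rightarrow>\<^sub>M counting_algebra d (X n)" for G
    unfolding projective_limit_space_def
  proof (rule measurable_restrict_space2)
    show "(\<lambda>\<xi>. \<xi>) \<in> G \<rightarrow>\<^sub>M Pi\<^sub>M {1..} (\<lambda>n. counting_algebra d (X n))"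
    proof (rule measurable_PiM_single'[where f="\<lambda>n \<xi>. \<xi> n"])
      show "(\<lambda>\<xi> n. \<xi> n) \<in> space G \<rightarrow> (\<Pi>\<^sub>E n\<in>{1..}. space (counting_algebra d (X n)))"
        unfolding G(1) by (auto simp: projective_limit_space_def space_restrict_space space_PiM)
    qed (simp add: G(2))
  qed (auto simp: G(1) projective_limit_space_def space_restrict_space)
  show "distr \<nu> (counting_algebra d (X n)) (\<lambda>\<xi>. \<xi> n) = distr \<nu>' (counting_algebra d (X n)) (\<lambda>\<xi>. \<xi> n)"
    if "1 \<le> n" for n
    using \<nu> that by (simp add: is_projective_limit_def)
qed

text \<open>The restrictions generate the \<sigma>-algebra on the whole space: by continuity from
  below, \<open>\<xi> A\<close> is the supremum of the masses of \<open>A \<inter> X n\<close> under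
  the restrictions.\<close>

lemma restricts_to_unique:
  fixes X :: "nat \<Rightarrow> 'a::topological_space set"
  assumes X: "\<And>n. 1 \<le> n \<Longrightarrow> X n \<in> sets borel" "\<And>n m. 1 \<le> n \<Longrightarrow> n \<le> m \<Longrightarrow> X n \<subseteq> X m"
    and Un: "(\<Union>n\<in>{1..}. X n) = UNIV"
    and P: "restricts_to d X \<mu> P" "restricts_to d X \<mu> Q"
  shows "P = Q"
proof (rule prob_measure_eqI_projections[where N="counting_algebra d UNIV"
      and f="\<lambda>n \<xi>. restrict_space \<xi> (X n)"
      and K="\<lambda>n. counting_algebra d (X n)" and h="\<lambda>n \<xi>. restrict_space \<xi> (X n)"])
  show "prob_space P" "sets P = sets (counting_algebra d UNIV)"
    "prob_space Q" "sets Q = sets (counting_algebra d UNIV)"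
    using P by (simp_all add: restricts_to_def point_process_def)
  show "(\<lambda>\<xi>. restrict_space \<xi> (X n)) \<in> counting_algebra d UNIV \<rightarrow>\<^sub>M counting_algebra d (X n)"
    if "1 \<le> n" for n
    using that by (intro measurable_restrict_counting_algebra X) auto
  show "(\<lambda>\<xi>. restrict_space \<xi> (X n)) \<in> counting_algebra d (X m) \<rightarrow>\<^sub>M counting_algebra d (X n)"
    if "1 \<le> n" "n \<le> m" for n m
    using that by (intro measurable_restrict_counting_algebra X) auto
  show "restrict_space (restrict_space \<xi> (X m)) (X n) = restrict_space \<xi> (X n)"
    if "1 \<le> n" "n \<le> m" "\<xi> \<in> space (counting_algebra d UNIV)" for n m \<xi>
    using that X by (intro restrict_restrict_counting_measures[of _ _ UNIV \<xi> d]) auto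
  show "(\<lambda>\<xi>. \<xi>) \<in> G \<rightarrow>\<^sub>M counting_algebra d UNIV"
    if G: "space G = space (counting_algebra d UNIV)"
      "\<And>n. 1 \<le> n \<Longrightarrow> (\<lambda>\<xi>. restrict_space \<xi> (X n)) \<in> G \<rightarrow>\<^sub>M counting_algebra d (X n)" for G
  proof (rule measurable_counting_algebraI)
    show "\<xi> \<in> counting_measures d UNIV" if "\<xi> \<in> space G" for \<xi>
      using that G(1) by simp
    fix A :: "'a set" assume "A \<in> sets (restrict_space borel UNIV)"
    then have A: "A \<in> sets borel" by simp
    \<comment> \<open>The shift by \<open>Suc\<close> turns the indices from 1 on into a sequence
      over all naturals, since \<open>X 0\<close> is arbitrary.\<close>
    have AX: "A \<inter> X (Suc n) \<in> sets (restrict_space borel (X (Suc n)))" for n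
      using A X(1)[of "Suc n"] by (simp add: sets_restrict_space_iff)
    have meas: "(\<lambda>\<xi>. emeasure (restrict_space \<xi> (X (Suc n))) (A \<inter> X (Suc n))) \<in> borel_measurable G" for n
      by (rule measurable_compose[OF G(2) measurable_emeasure_counting_algebra[OF AX]]) simp
    have "emeasure \<xi> A = (SUP n. emeasure (restrict_space \<xi> (X (Suc n))) (A \<inter> X (Suc n)))"
      if "\<xi> \<in> space G" for \<xi>
    proof -
      have \<xi>: "\<xi> \<in> counting_measures d UNIV" using that G(1) by simp
      have "(SUP n. emeasure (restrict_space \<xi> (X (Suc n))) (A \<inter> X (Suc n))) =
          (SUP n. emeasure \<xi> (A \<inter> X (Suc n)))"
        using restrict_counting_measures(2)[OF X(1) _ _ \<xi> AX] by (intro SUP_cong) auto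
      also have "\<dots> = emeasure \<xi> (\<Union>n. A \<inter> X (Suc n))"
      proof (rule SUP_emeasure_incseq)
        show "incseq (\<lambda>n. A \<inter> X (Suc n))" by (intro monoI Int_mono X(2)) auto
        show "range (\<lambda>n. A \<inter> X (Suc n)) \<subseteq> sets \<xi>"
          using A X(1) by (auto simp: sets_counting_measure[OF \<xi>])
      qed
      also have "(\<Union>n. A \<inter> X (Suc n)) = A"
      proof -
        have "\<exists>n. x \<in> X (Suc n)" for x
        proof -
          obtain n where "1 \<le> n" "x \<in> X n" using Un by blast
          then show ?thesis by (cases n) auto
        qed
        then show ?thesis by auto
      qed
      finally show ?thesis ..
    qed
    then show "(\<lambda>\<xi>. emeasure \<xi> A) \<in> borel_measurable G"
      by (subst measurable_cong) (auto intro: borel_measurable_SUP meas)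
  qed
  show "distr P (counting_algebra d (X n)) (\<lambda>\<xi>. restrict_space \<xi> (X n)) =
      distr Q (counting_algebra d (X n)) (\<lambda>\<xi>. restrict_space \<xi> (X n))" if "1 \<le> n" for n
    using P that by (simp add: restricts_to_def)
qed

section \<open>Metrics and partitions adapted to an exhaustion\<close>

text \<open>The new metric dominates \<open>dist\<close>, so its Cauchy sequences converge;
  continuity of \<open>f\<close> keeps the topology. The extra term forces \<open>f\<close> to be
  bounded on bounded sets.\<close>

lemma complete_metric_add_dist:
  fixes f :: "'a::complete_space \<Rightarrow> real"
  assumes "continuous_on UNIV f"
  shows "complete_metric (\<lambda>x y. dist x y + \<bar>f x - f y\<bar>)"
proof -
  let ?d = "\<lambda>x y. dist x y + \<bar>f x - f y\<bar>"
  interpret Metric_space UNIV ?d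
  proof
    show "?d x z \<le> ?d x y + ?d y z" for x y z
      using dist_triangle[of x z y] by linarith
    show "?d x y = 0 \<longleftrightarrow> x = y" for x y
      using zero_le_dist[of x y] by (auto simp: add_nonneg_eq_0_iff)
  qed (auto simp: dist_commute)
  have "(\<forall>x\<in>U. \<exists>r>0. mball x r \<subseteq> U) \<longleftrightarrow> open U" for U
  proof
    assume U: "\<forall>x\<in>U. \<exists>r>0. mball x r \<subseteq> U"
    show "open U"
      unfolding open_dist
    proof
      fix x assume "x \<in> U"
      then obtain r where r: "r > 0" "mball x r \<subseteq> U" using U by blast
      \<comment> \<open>Half of the radius is reserved for the change of \<open>f\<close>, the other
        half for \<open>dist\<close>.\<close>
      have "isCont f x" using assms by (simp add: continuous_on_eq_continuous_at)
      then obtain s where s: "s > 0" "\<And>y. dist y x < s \<Longrightarrow> dist (f y) (f x) < r / 2"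
        using r(1) unfolding continuous_at_eps_delta by (metis half_gt_zero)
      have "y \<in> U" if "dist y x < min s (r / 2)" for y
      proof -
        have "?d x y < r"
          using s(2)[of y] that by (simp add: dist_real_def dist_commute abs_minus_commute)
        then show ?thesis using r(2) by (auto simp: mball_def)
      qed
      then show "\<exists>e>0. \<forall>y. dist y x < e \<longrightarrow> y \<in> U"
        using s(1) r(1) by (intro exI[of _ "min s (r / 2)"]) auto
    qed
  next
    assume "open U"
    show "\<forall>x\<in>U. \<exists>r>0. mball x r \<subseteq> U"
    proof
      fix x assume "x \<in> U"
      then obtain r where r: "r > 0" "\<And>y. dist y x < r \<Longrightarrow> y \<in> U"
        using \<open>open U\<close> unfolding open_dist by blast
      have "y \<in> U" if "?d x y < r" for y
        by (rule r(2)) (use that in \<open>simp add: dist_commute\<close>)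
      with r(1) show "\<exists>r>0. mball x r \<subseteq> U" by (auto simp: mball_def)
    qed
  qed
  then have top: "mtopology = euclidean"
    by (intro topology_eq[THEN iffD2]) (auto simp: openin_mtopology)
  have "\<exists>x. limitin mtopology \<sigma> x sequentially" if \<sigma>: "MCauchy \<sigma>" for \<sigma>
  proof -
    have "Cauchy \<sigma>"
      unfolding Cauchy_def
    proof (intro allI impI)
      fix e :: real assume "e > 0"
      then obtain N where N: "\<And>m n. N \<le> m \<Longrightarrow> N \<le> n \<Longrightarrow> ?d (\<sigma> m) (\<sigma> n) < e"
        using \<sigma> unfolding MCauchy_def by blast
      have "dist (\<sigma> m) (\<sigma> n) < e" if "N \<le> m" "N \<le> n" for m n
        using N[OF that] by linarith
      then show "\<exists>M. \<forall>m\<ge>M. \<forall>n\<ge>M. dist (\<sigma> m) (\<sigma> n) < e" by blast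
    qed
    then show ?thesis
      unfolding top limitin_canonical_iff using Cauchy_convergent convergent_def by blast
  qed
  then show ?thesis
    unfolding complete_metric_def mcomplete_def using top Metric_space_axioms by blast
qed

text \<open>The function is \<open>1 / s\<close>, where \<open>s\<close> sums the truncated
  distances to the complements of the \<open>X n\<close> with weights \<open>(1/2)^n\<close>. The
  sum is continuous and positive, but at most \<open>(1/2)^n\<close> off \<open>X n\<close>, so
  \<open>1 / s\<close> is at least \<open>2^n\<close> there.\<close>

lemma exhausting_function:
  fixes X :: "nat \<Rightarrow> 'a::metric_space set"
  assumes op: "\<And>n. open (X n)" and mono: "\<And>n m. n \<le> m \<Longrightarrow> X n \<subseteq> X m"
    and Un: "(\<Union>n. X n) = UNIV"
  obtains f :: "'a \<Rightarrow> real" where "continuous_on UNIV f" "\<And>c. \<exists>n. {x. f x \<le> c} \<subseteq> X n"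
proof (cases "\<exists>n. X n = UNIV")
  \<comment> \<open>This case is separated because \<open>infdist\<close> to the empty set is 0, so
    the term \<open>g n\<close> would vanish where \<open>X n\<close> is everything.\<close>
  case True
  then show thesis by (intro that[of "\<lambda>_. 0"]) auto
next
  case False
  define g where "g n x = min 1 (infdist x (- X n)) * (1/2)^n" for n x
  define s where "s x = (\<Sum>n. g n x)" for x
  have g_nonneg: "0 \<le> g n x" and g_le: "g n x \<le> (1/2)^n" for n x
    by (auto simp: g_def infdist_nonneg intro!: mult_nonneg_nonneg mult_left_le_one_le)
  have geom: "summable (\<lambda>n. (1/2::real)^n)" by (rule summable_geometric) simp
  have summ: "summable (\<lambda>n. g n x)" for x
    using g_nonneg g_le by (intro summable_comparison_test'[OF geom, of 0]) auto
  have "uniform_limit UNIV (\<lambda>n x. \<Sum>i<n. g i x) (\<lambda>x. \<Sum>i. g i x) sequentially"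
    using g_nonneg g_le geom by (intro Weierstrass_m_test) auto
  moreover have "continuous_on UNIV (\<lambda>x. \<Sum>i<n. g i x)" for n
    unfolding g_def by (intro continuous_intros)
  ultimately have s_cont: "continuous_on UNIV s"
    unfolding s_def by (intro uniform_limit_theorem[where F=sequentially]) auto
  have s_pos: "0 < s x" for x
  proof -
    obtain n where n: "x \<in> X n" using Un by blast
    have "infdist x (- X n) > 0"
      using n op[of n] False in_closed_iff_infdist_zero[of "- X n" x] infdist_nonneg[of x "- X n"]
      by (auto simp: less_le)
    then have "0 < g n x" by (simp add: g_def)
    then show ?thesis
      unfolding s_def using summ g_nonneg by (intro suminf_pos2[where i=n]) auto
  qed
  \<comment> \<open>The terms up to and including index \<open>n\<close> vanish, and the remaining
    geometric tail sums to exactly \<open>(1/2)^n\<close>.\<close>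
  have s_le: "s x \<le> (1/2)^n" if "x \<notin> X n" for x n
  proof -
    have z: "g m x = 0" if "m \<le> n" for m
    proof -
      have "x \<in> - X m" using \<open>x \<notin> X n\<close> mono[OF that] by auto
      then show ?thesis by (simp add: g_def infdist_zero)
    qed
    have "s x = (\<Sum>i. g (i + Suc n) x) + (\<Sum>i<Suc n. g i x)"
      unfolding s_def by (rule suminf_split_initial_segment[OF summ])
    also have "(\<Sum>i<Suc n. g i x) = 0" using z by (intro sum.neutral) auto
    also have "(\<Sum>i. g (i + Suc n) x) \<le> (\<Sum>i. (1/2)^i * (1/2)^Suc n)"
    proof (rule suminf_le)
      show "g (i + Suc n) x \<le> (1/2)^i * (1/2)^Suc n" for i
        using g_le[of "i + Suc n" x] by (simp only: power_add)
      show "summable (\<lambda>i. g (i + Suc n) x)" using summ by (rule summable_ignore_initial_segment)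
      show "summable (\<lambda>i. (1/2)^i * (1/2::real)^Suc n)" using geom by (rule summable_mult2)
    qed
    also have "\<dots> = (1/2)^n"
      using suminf_mult2[OF geom, of "(1/2)^Suc n"] suminf_geometric[of "1/2::real"] by simp
    finally show ?thesis by simp
  qed
  show thesis
  proof (rule that[of "\<lambda>x. 1 / s x"])
    show "continuous_on UNIV (\<lambda>x. 1 / s x)"
      using s_pos by (intro continuous_intros s_cont) (metis less_irrefl)
    fix c :: real
    obtain n where n: "c < 2 ^ n" using real_arch_pow[of 2 c] by auto
    have "2 ^ n \<le> 1 / s x" if "x \<notin> X n" for x
      using s_le[OF that] s_pos[of x] by (simp add: field_simps power_divide)
    then have "{x. 1 / s x \<le> c} \<subseteq> X n"
      using n by force
    then show "\<exists>n. {x. 1 / s x \<le> c} \<subseteq> X n" by blast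
  qed
qed

text \<open>On a ball of radius \<open>r\<close> around \<open>x\<close> in the new metric,
  \<open>f\<close> is at most \<open>f x + r\<close>; a bounded set therefore lies in a sublevel set
  of \<open>f\<close>, and so in some \<open>X n\<close>.\<close>

lemma exists_bounded_exhaustion_metric:
  fixes X :: "nat \<Rightarrow> 'a::complete_space set"
  assumes op: "\<And>n. n \<ge> 1 \<Longrightarrow> open (X n)" and mono: "\<And>n m. 1 \<le> n \<Longrightarrow> n \<le> m \<Longrightarrow> X n \<subseteq> X m"
    and Un: "(\<Union>n\<in>{1..}. X n) = UNIV"
  shows "\<exists>d. complete_metric d \<and> bounded_exhaustion d X"
proof -
  have "(\<Union>n. X (Suc n)) = UNIV"
    using Un by (auto simp: set_eq_iff) (metis Suc_le_D atLeast_iff)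
  then obtain f :: "'a \<Rightarrow> real" where f: "continuous_on UNIV f" "\<And>c. \<exists>n. {x. f x \<le> c} \<subseteq> X (Suc n)"
    using exhausting_function[of "\<lambda>n. X (Suc n)"] op mono by (metis Suc_le_mono le_add1 plus_1_eq_Suc)
  let ?d = "\<lambda>x y. dist x y + \<bar>f x - f y\<bar>"
  have cm: "complete_metric ?d" using f(1) by (rule complete_metric_add_dist)
  then interpret Metric_space UNIV ?d by (simp add: complete_metric_def)
  have "\<exists>n\<ge>1. B \<subseteq> X n" if "mbounded B" for B
  proof -
    obtain x r where "B \<subseteq> mcball x r" using \<open>mbounded B\<close> mbounded_def by blast
    then have "?d x y \<le> r" if "y \<in> B" for y using that by (auto simp: mcball_def)
    then have "f y \<le> f x + r" if "y \<in> B" for y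
      using that zero_le_dist[of x y] by (smt (verit))
    moreover obtain n where "{y. f y \<le> f x + r} \<subseteq> X (Suc n)" using f(2) by blast
    ultimately show ?thesis by (intro exI[of _ "Suc n"]) auto
  qed
  then show ?thesis using cm unfolding bounded_exhaustion_def by blast
qed

section \<open>A partition adapted to the exhaustion and the metric\<close>

text \<open>The pieces are the layers \<open>X (k + 1)\<close> minus the earlier sets, cut by annuli
  around a fixed centre. A bounded subset of \<open>X n\<close> meets only layers of level at most
  \<open>n\<close> and only finitely many annuli.\<close>

lemma bounded_level_partition:
  fixes X :: "nat \<Rightarrow> 'a::topological_space set"
  assumes d: "complete_metric d"
    and X: "\<And>n. 1 \<le> n \<Longrightarrow> open (X n)" "\<And>n m. 1 \<le> n \<Longrightarrow> n \<le> m \<Longrightarrow> X n \<subseteq> X m"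
    and Un: "(\<Union>n\<in>{1..}. X n) = UNIV"
  obtains D :: "nat \<Rightarrow> 'a set" and lev :: "nat \<Rightarrow> nat"
  where "disjoint_family D" "(\<Union>p. D p) = UNIV" "\<And>p. D p \<in> sets borel"
    "\<And>p. Metric_space.mbounded UNIV d (D p)"
    "\<And>n B. 1 \<le> n \<Longrightarrow> Metric_space.mbounded UNIV d B \<Longrightarrow> B \<subseteq> X n \<Longrightarrow> finite {p. D p \<inter> B \<noteq> {}}"
    "\<And>n p. 1 \<le> n \<Longrightarrow> lev p \<le> n \<Longrightarrow> D p \<subseteq> X n" "\<And>n p. 1 \<le> n \<Longrightarrow> n < lev p \<Longrightarrow> D p \<inter> X n = {}"
proof -
  interpret Metric_space UNIV d using d by (simp add: complete_metric_def)
  fix x0 :: 'a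
  have top: "mtopology = euclidean" using d by (simp add: complete_metric_def)
  define S where "S = disjointed (\<lambda>k. X (Suc k))"
  define A where "A = disjointed (\<lambda>r. mball x0 (real r))"
  define D where "D p = S (fst (prod_decode p)) \<inter> A (snd (prod_decode p))" for p
  \<comment> \<open>Layer \<open>k\<close> is contained in \<open>X (Suc k)\<close>, whence the
    successor.\<close>
  define lev where "lev p = Suc (fst (prod_decode p))" for p
  have SX: "S k \<subseteq> X (Suc k)" and Ab: "A r \<subseteq> mball x0 (real r)" for k r
    unfolding S_def A_def by (rule disjointed_subset)+
  have open_ball: "open (mball x0 r)" for r
    using openin_mball[of x0 r] by (simp add: top)
  have "range S \<subseteq> sets borel"
    unfolding S_def using X(1) by (intro sets.range_disjointed_sets) auto
  moreover have "range A \<subseteq> sets borel"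
    unfolding A_def using open_ball by (intro sets.range_disjointed_sets) auto
  ultimately have borel: "D p \<in> sets borel" for p
    unfolding D_def by (intro sets.Int) auto
  have "disjoint_family S" "disjoint_family A"
    unfolding S_def A_def by (rule disjoint_family_disjointed)+
  then have "D p \<inter> D q = {}" if "fst (prod_decode p) \<noteq> fst (prod_decode q) \<or> snd (prod_decode p) \<noteq> snd (prod_decode q)" for p q
    using that unfolding D_def disjoint_family_on_def by blast
  then have disj: "disjoint_family D"
    unfolding disjoint_family_on_def by (metis prod_decode_eq prod_eqI)
  have US: "(\<Union>k. S k) = UNIV"
  proof -
    have "\<exists>n. x \<in> X (Suc n)" for x
    proof -
      obtain n where "1 \<le> n" "x \<in> X n" using Un by blast
      then show ?thesis by (cases n) auto
    qed
    then show ?thesis unfolding S_def UN_disjointed_eq by auto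
  qed
  have UA: "(\<Union>r. A r) = UNIV"
  proof -
    have "\<exists>r::nat. x \<in> mball x0 (real r)" for x
      using reals_Archimedean2[of "d x0 x"] by (auto simp: mball_def)
    then show ?thesis unfolding A_def UN_disjointed_eq by auto
  qed
  have UD: "(\<Union>p. D p) = UNIV"
  proof -
    have "\<exists>p. x \<in> D p" for x
    proof -
      obtain k r where "x \<in> S k" "x \<in> A r" using US UA by blast
      then have "x \<in> D (prod_encode (k, r))" by (simp add: D_def)
      then show ?thesis ..
    qed
    then show ?thesis by auto
  qed
  have bounded: "mbounded (D p)" for p
    using Ab mbounded_mball mbounded_subset unfolding D_def by (metis inf.coboundedI2)
  have lev1: "D p \<subseteq> X n" if "lev p \<le> n" for n p
    using SX[of "fst (prod_decode p)"] X(2)[of "lev p" n] that unfolding D_def lev_def by auto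
  have lev2: "D p \<inter> X n = {}" if "1 \<le> n" "n < lev p" for n p
  proof -
    obtain k where k: "n = Suc k" using \<open>1 \<le> n\<close> by (cases n) auto
    then have "k < fst (prod_decode p)" using that by (simp add: lev_def)
    then show ?thesis unfolding D_def S_def disjointed_def k by auto
  qed
  have fin: "finite {p. D p \<inter> B \<noteq> {}}" if n: "1 \<le> n" and B: "mbounded B" "B \<subseteq> X n" for n B
  proof -
    \<comment> \<open>The bounding ball may have any centre \<open>y\<close>. The triangle
      inequality encloses \<open>B\<close> in a ball of radius \<open>R\<close> around
      \<open>x0\<close>, which the annuli with index above \<open>R\<close> miss.\<close>
    obtain y c where c: "B \<subseteq> mcball y c" using B(1) by (auto simp: mbounded_def)
    obtain R :: nat where R: "d x0 y + c < real R" using reals_Archimedean2 by blast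
    have BR: "x \<in> mball x0 (real R)" if "x \<in> B" for x
      using c that triangle[of x0 y x] R by (force simp: mball_def mcball_def)
    have "{p. D p \<inter> B \<noteq> {}} \<subseteq> prod_encode ` ({..n} \<times> {..R})"
    proof
      fix p assume "p \<in> {p. D p \<inter> B \<noteq> {}}"
      then obtain x where x: "x \<in> D p" "x \<in> B" by blast
      then have "lev p \<le> n" using lev2[OF n, of p] B(2) by (cases "lev p \<le> n") auto
      moreover have "snd (prod_decode p) \<le> R"
      proof (rule ccontr)
        assume "\<not> snd (prod_decode p) \<le> R"
        then show False using x BR[OF x(2)] unfolding D_def A_def disjointed_def by auto
      qed
      ultimately have "prod_decode p \<in> {..n} \<times> {..R}"
        by (simp add: lev_def mem_Times_iff)
      then have "prod_encode (prod_decode p) \<in> prod_encode ` ({..n} \<times> {..R})" by (rule imageI)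
      then show "p \<in> prod_encode ` ({..n} \<times> {..R})" by simp
    qed
    then show ?thesis by (rule finite_subset) simp
  qed
  show thesis
    by (rule that[OF disj UD borel bounded fin lev1 lev2])
qed

section \<open>The projective limit\<close>

text \<open>The point process on the whole space is obtained under
  \<open>bounded_exhaustion\<close>; the last conjunct ensures that this condition can always be
  met.\<close>

theorem theorem3p2:
  fixes X :: "nat \<Rightarrow> 'a::polish_space set"
  assumes "\<And>n. n \<ge> 1 \<Longrightarrow> open (X n)"
    and "\<And>n m. 1 \<le> n \<Longrightarrow> n \<le> m \<Longrightarrow> X n \<subseteq> X m"
    and "(\<Union>n\<in>{1..}. X n) = UNIV"
  shows "(\<forall>d \<mu>. complete_metric d \<and> projective_system d X \<mu> \<longrightarrow>
       (\<exists>!\<nu>. is_projective_limit d X \<mu> \<nu>) \<and>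
       (\<forall>P Q. restricts_to d X \<mu> P \<and> restricts_to d X \<mu> Q \<longrightarrow> P = Q) \<and>
       (bounded_exhaustion d X \<longrightarrow>
         (\<exists>P. restricts_to d X \<mu> P \<and>
           is_projective_limit d X \<mu>
             (distr P (projective_limit_space d X) (\<lambda>\<xi>. \<lambda>n\<in>{1..}. restrict_space \<xi> (X n)))))) \<and>
     (\<exists>d. complete_metric d \<and> bounded_exhaustion d X)"
proof (intro conjI allI impI)
  have X: "X n \<in> sets borel" if "1 \<le> n" for n
    using assms(1)[OF that] by simp
  fix d :: "'a \<Rightarrow> 'a \<Rightarrow> real" and \<mu>
  assume "complete_metric d \<and> projective_system d X \<mu>"
  then have d: "complete_metric d" and \<mu>: "projective_system d X \<mu>" by auto
  obtain D :: "nat \<Rightarrow> 'a set" and lev :: "nat \<Rightarrow> nat" where D: "disjoint_family D" "(\<Union>p. D p) = UNIV" "\<And>p. D p \<in> sets borel"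
    and bounded: "\<And>p. Metric_space.mbounded UNIV d (D p)"
    and fin: "\<And>n B. 1 \<le> n \<Longrightarrow> Metric_space.mbounded UNIV d B \<Longrightarrow> B \<subseteq> X n \<Longrightarrow> finite {p. D p \<inter> B \<noteq> {}}"
    and lev: "\<And>n p. 1 \<le> n \<Longrightarrow> lev p \<le> n \<Longrightarrow> D p \<subseteq> X n" "\<And>n p. 1 \<le> n \<Longrightarrow> n < lev p \<Longrightarrow> D p \<inter> X n = {}"
    by (rule bounded_level_partition[OF d assms]; (assumption | (rule that; assumption)))
  obtain \<B> :: "'a set set" where \<B>: "countable \<B>" "topological_basis \<B>"
    using ex_countable_basis by blast
  then have "\<B> \<noteq> {}"
    using topological_basisE[OF \<B>(2) open_UNIV UNIV_I] by blast
  then have U: "topological_basis (range (from_nat_into \<B>))"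
    using \<B> by (simp add: range_from_nat_into)
  obtain L where L: "prob_space L" "sets L = sets (Pi\<^sub>M UNIV (\<lambda>_. borel))"
    and law: "\<And>n. 1 \<le> n \<Longrightarrow> distr L (counting_algebra d (X n)) (decode D (X n)) = \<mu> n"
    by (rule distr_decode_eq[OF X assms(2) D bounded fin lev U \<mu>]; (assumption | (rule that; assumption)))
  have dec: "decode D (X n) \<in> L \<rightarrow>\<^sub>M counting_algebra d (X n)" if "1 \<le> n" for n
    unfolding measurable_cong_sets[OF L(2) refl] by (rule measurable_decode[OF D X[OF that] fin[OF that]])
  have proj: "(\<lambda>\<xi>. \<xi> n) \<in> projective_limit_space d X \<rightarrow>\<^sub>M counting_algebra d (X n)" if "1 \<le> n" for n
    unfolding projective_limit_space_def
    using that by (intro measurable_restrict_space1 measurable_component_singleton) simp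
  \<comment> \<open>One random code is decoded on all \<open>X n\<close> simultaneously, which makes
    the sequence compatible for every code. Restricting the index set puts it in the extensional
    product over \<open>{1..}\<close>.\<close>
  define g where "g \<omega> = (\<lambda>n\<in>{1..}. decode D (X n) \<omega>)" for \<omega>
  have dec_restr: "restrict_space (decode D (X m) \<omega>) (X n) = decode D (X n) \<omega>" if "1 \<le> n" "n \<le> m" for n m \<omega>
    using that by (intro restrict_decode X assms(2)) auto
  have g: "g \<in> L \<rightarrow>\<^sub>M projective_limit_space d X"
    unfolding projective_limit_space_def
  proof (rule measurable_restrict_space2)
    show "g \<in> space L \<rightarrow> {\<xi>. \<forall>n m. 1 \<le> n \<and> n \<le> m \<longrightarrow> restrict_space (\<xi> m) (X n) = \<xi> n}"
      by (auto simp: g_def dec_restr)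
    show "g \<in> L \<rightarrow>\<^sub>M Pi\<^sub>M {1..} (\<lambda>n. counting_algebra d (X n))"
      unfolding g_def using dec by (intro measurable_restrict) simp
  qed
  have lim: "is_projective_limit d X \<mu> (distr L (projective_limit_space d X) g)"
    unfolding is_projective_limit_def
  proof (intro conjI allI impI)
    show "prob_space (distr L (projective_limit_space d X) g)"
      using L(1) g by (rule prob_space.prob_space_distr)
    fix n :: nat assume n: "1 \<le> n"
    have "distr (distr L (projective_limit_space d X) g) (counting_algebra d (X n)) (\<lambda>\<xi>. \<xi> n) =
        distr L (counting_algebra d (X n)) (decode D (X n))"
      unfolding distr_distr[OF proj[OF n] g] using n by (simp add: o_def g_def)
    then show "distr (distr L (projective_limit_space d X) g) (counting_algebra d (X n)) (\<lambda>\<xi>. \<xi> n) = \<mu> n"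
      by (simp add: law[OF n])
  qed simp
  then show "\<exists>!\<nu>. is_projective_limit d X \<mu> \<nu>"
  proof (rule ex1I)
    fix \<nu> assume "is_projective_limit d X \<mu> \<nu>"
    from this lim show "\<nu> = distr L (projective_limit_space d X) g"
      by (rule is_projective_limit_unique[OF X assms(2), rotated -2])
  qed
  show "P = Q" if "restricts_to d X \<mu> P \<and> restricts_to d X \<mu> Q" for P Q
    using that[THEN conjunct1] that[THEN conjunct2]
    by (rule restricts_to_unique[OF X assms(2,3), rotated -2])
  assume ex: "bounded_exhaustion d X"
  \<comment> \<open>This is where the metric enters: a bounded set lies in some \<open>X n\<close>
    and so meets finitely many pieces. Codes can then be decoded on the whole space, and their law
    \<open>L\<close> yields the point process.\<close>
  have fin_UNIV: "finite {p. D p \<inter> B \<noteq> {}}" if "Metric_space.mbounded UNIV d B" for B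
    using ex fin that unfolding bounded_exhaustion_def by blast
  have dec_UNIV: "decode D UNIV \<in> L \<rightarrow>\<^sub>M counting_algebra d UNIV"
    unfolding measurable_cong_sets[OF L(2) refl] by (rule measurable_decode[OF D _ fin_UNIV]) simp
  define P where "P = distr L (counting_algebra d UNIV) (decode D UNIV)"
  have rest: "(\<lambda>\<xi>. restrict_space \<xi> (X n)) \<in> counting_algebra d UNIV \<rightarrow>\<^sub>M counting_algebra d (X n)"
    if "1 \<le> n" for n
    using that by (intro measurable_restrict_counting_algebra X) auto
  have P_rest: "distr P (counting_algebra d (X n)) (\<lambda>\<xi>. restrict_space \<xi> (X n)) = \<mu> n" if n: "1 \<le> n" for n
  proof -
    have "restrict_space (decode D UNIV \<omega>) (X n) = decode D (X n) \<omega>" for \<omega>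
      using X[OF n] by (intro restrict_decode) auto
    then show ?thesis
      unfolding P_def distr_distr[OF rest[OF n] dec_UNIV] by (simp add: o_def law[OF n])
  qed
  have P: "prob_space P"
    unfolding P_def using L(1) dec_UNIV by (rule prob_space.prob_space_distr)
  let ?r = "\<lambda>\<xi>. \<lambda>n\<in>{1..}. restrict_space \<xi> (X n)"
  have restr_restr: "restrict_space (restrict_space \<xi> (X m)) (X n) = restrict_space \<xi> (X n)"
    if "1 \<le> n" "n \<le> m" "\<xi> \<in> counting_measures d UNIV" for n m \<xi>
    using that by (intro restrict_restrict_counting_measures[of _ _ UNIV \<xi> d] X assms(2)) auto
  have r: "?r \<in> P \<rightarrow>\<^sub>M projective_limit_space d X"
    unfolding projective_limit_space_def
  proof (rule measurable_restrict_space2)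
    show "?r \<in> space P \<rightarrow> {\<xi>. \<forall>n m. 1 \<le> n \<and> n \<le> m \<longrightarrow> restrict_space (\<xi> m) (X n) = \<xi> n}"
      by (auto simp: P_def restr_restr)
    show "?r \<in> P \<rightarrow>\<^sub>M Pi\<^sub>M {1..} (\<lambda>n. counting_algebra d (X n))"
      unfolding P_def using rest by (intro measurable_restrict) simp
  qed
  have "is_projective_limit d X \<mu> (distr P (projective_limit_space d X) ?r)"
    unfolding is_projective_limit_def
  proof (intro conjI allI impI)
    show "prob_space (distr P (projective_limit_space d X) ?r)"
      using P r by (rule prob_space.prob_space_distr)
    fix n :: nat assume n: "1 \<le> n"
    show "distr (distr P (projective_limit_space d X) ?r) (counting_algebra d (X n)) (\<lambda>\<xi>. \<xi> n) = \<mu> n"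
      unfolding distr_distr[OF proj[OF n] r] using n by (simp add: o_def P_rest[OF n])
  qed simp
  moreover have "restricts_to d X \<mu> P"
    using P P_rest by (simp add: restricts_to_def point_process_def P_def)
  ultimately show "\<exists>P. restricts_to d X \<mu> P \<and> is_projective_limit d X \<mu> (distr P (projective_limit_space d X) ?r)"
    by blast
next
  show "\<exists>d. complete_metric d \<and> bounded_exhaustion d X"
    using assms by (rule exists_bounded_exhaustion_metric)
qed

end
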